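(* Let $\alpha\in(0,1)$ be fixed. In the triangular-array setting of the context (independent random vectors $(X_{i,1},\dots,X_{i,p})$, $i=1,\dots,n$, with common means $\mathbb{E}X_{i,j}=\mu_j$, and subsets $\mathcal S_1,\dots,\mathcal S_d\subset\{1,\dots,p\}$, $d\ge 2$, each of cardinality $q$), assume: (A) there is a constant $c_0>0$ (independent of $n$) such that $\rho_i(m)\le \exp(-2c_0 m)$ for all $1\le m\le p-1$, uniformly for all $1\le i\le n$; (B$'$) there is a constant $c>0$ (independent of $n$) such that $\mathrm{Var}(Y_i^{(\ell)})\ge c\sum_{j\in\mathcal S_\ell}\mathrm{Var}(X_{i,j})$ uniformly for all $1\le i\le n$ and $1\le \ell\le d$; (C$'$) as $n\to\infty$, $$\frac{s_{n,\max}^{(4)}}{(s_{n,\min}^{(2)})^2}=o(1)\,\frac{nq}{\log^5(pn)},\qquad \frac{s_{n,\max}^{(2)}}{s_{n,\min}^{(2)}}=o(1)\min\left\{\left(\frac{n}{\log^5(pn)}\right)^{1/2},\ \log^2 p\right\};$$ (D) as $n\to\infty$, $q<p$, $\log q=O(1)\log p$, $\log d=O(1)\log p$, $\dfrac{n}{\log^5(pn)}\to\infty$ and $\dfrac{nq\,s_{n,\min}^{(2)}}{\log^9(pn)}\to\infty$; and, moreover, $\max_{1\le i\le n}\max_{1\le j\le p}|X_{i,j}|\le C$ for some constant $C>0$ (independent of $n$). Then, under the local alternative $$H_1:\quad \max_{1\le\ell\le d}\frac{\big|\sum_{j\in\mathcal S_\ell}\mu_j\big|}{\sqrt{q\,s_{n,\max}^{(2)}}}\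 \ge\ \frac{\sqrt{\lambda\log d}}{\sqrt n},\qquad \lambda=\lambda_n\to\infty\ \text{ as } n\to\infty,$$ we have, as $n\to\infty$, $$\Pr(\mathcal M>c_\alpha)\to1 .$$
   Context: For each sample size $n$, $(X_{i,1},\dots,X_{i,p})=(X^{(n)}_{i,1},\dots,X^{(n)}_{i,p})$, $i=1,\dots,n$, are independent (not necessarily identically distributed) random vectors; all quantities, including $p$, $q$, $d$, the subsets and the distributions, may depend on $n$. For each $j$, $\mathbb{E}X_{1,j}=\dots=\mathbb{E}X_{n,j}=:\mu_j$. Mixing coefficients: $\mathcal F_{i,a,b}$ is the $\sigma$-field generated by $X_{i,a},X_{i,a+1},\dots,X_{i,b}$, and $$\rho_i(m)=\sup_{1\le k\le p-m}\ \sup_{Z_1,Z_2}\left|\frac{\mathrm{Cov}(Z_1,Z_2)}{(\mathbb{E}Z_1^2\,\mathbb{E}Z_2^2)^{1/2}}\right|,$$ where the inner supremum is over square-integrable, not a.s. zero, random variables $Z_1$ measurable with respect to $\mathcal F_{i,1,k}$ and $Z_2$ measurable with respect to $\mathcal F_{i,k+m,p}$. Moments: $s_{n,\max}^{(4)}=\max_{i\le n,\,j\le p}\mathbb{E}(X_{i,j}-\mu_j)^4$, $s_{n,\max}^{(2)}=\max_{i\le n,\,j\le p}\mathbb{E}(X_{i,j}-\mu_j)^2$, $s_{n,\min}^{(2)}=\min_{i\le n,\,j\le p}\mathbb{E}(X_{i,j}-\mu_j)^2$. Test statistic: $\mathcal S_1,\dots,\mathcal S_d$ are (possibly overlapping)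 subsets of $\{1,\dots,p\}$, each of cardinality $q$. Put $Y_i^{(\ell)}=\sum_{j\in\mathcal S_\ell}X_{i,j}$, $\widehat\sigma_{\ell\ell}=\frac1n\sum_{i=1}^n\big(Y_i^{(\ell)}-\frac1n\sum_{k=1}^nY_k^{(\ell)}\big)^2$, $T^{(\ell)}=\dfrac{\sum_{i=1}^nY_i^{(\ell)}}{\sqrt{n\widehat\sigma_{\ell\ell}}}$ and $\mathcal M=\max_{1\le\ell\le d}|T^{(\ell)}|$. Bootstrap critical value: $\xi_1,\dots,\xi_n$ are i.i.d. $N(0,1)$ independent of the data, $T_B^{(\ell)}=\dfrac{\sum_{i=1}^n\xi_iY_i^{(\ell)}}{\sqrt{n\widehat\sigma_{\ell\ell}}}$, $\mathcal M_B=\max_{1\le\ell\le d}|T_B^{(\ell)}|$, and $c_\alpha$ is the $(1-\alpha)$ conditional quantile of $\mathcal M_B$ given the data $(X_{i,j})_{i\le n,j\le p}$. When $\widehat\sigma_{\ell\ell}=0$, the ratios $T^{(\ell)},T^{(\ell)}_B$ are set to $0$ by convention. *)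

theory Defs
  imports "HOL-Probability.Probability" "HOL-Library.Landau_Symbols"
begin

definition gen_sigma :: "'a measure \<Rightarrow> 'i set \<Rightarrow> ('i \<Rightarrow> 'a \<Rightarrow> real) \<Rightarrow> 'a measure" where
  "gen_sigma M I Z = sigma (space M) (\<Union>j\<in>I. {Z j -` B \<inter> space M | B. B \<in> sets borel})"

definition covar :: "'a measure \<Rightarrow> ('a \<Rightarrow> real) \<Rightarrow> ('a \<Rightarrow> real) \<Rightarrow> real" where
  "covar M U V =
     (\<integral>\<omega>. (U \<omega> - (\<integral>x. U x \<partial>M)) * (V \<omega> - (\<integral>x. V x \<partial>M)) \<partial>M)"

definition L2_nonzero :: "'a measure \<Rightarrow> 'a measure \<Rightarrow> ('a \<Rightarrow> real) set" where
  "L2_nonzero M F =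
     {Z \<in> borel_measurable F. integrable M (\<lambda>\<omega>. (Z \<omega>)\<^sup>2) \<and> \<not> (AE \<omega> in M. Z \<omega> = 0)}"

text \<open>
  The maximal-correlation mixing coefficient of a row \<open>Z 1, \<dots>, Z p\<close>. The
  normalisation uses uncentred second moments. For \<open>1 \<le> m \<le> p - 1\<close> on a probability space, both
  suprema range over nonempty families bounded by 1 (Cauchy-Schwarz), so the real-valued
  supremum is the genuine one.
\<close>
definition rho_mixing :: "'a measure \<Rightarrow> nat \<Rightarrow> (nat \<Rightarrow> 'a \<Rightarrow> real) \<Rightarrow> nat \<Rightarrow> real" where
  "rho_mixing M p Z m =
     (SUP k\<in>{1..p - m}.
        SUP (U, V)\<in>L2_nonzero M (gen_sigma M {1..k} Z) \<times> L2_nonzero M (gen_sigma M {k + m..p} Z).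
          \<bar>covar M U V / sqrt ((\<integral>\<omega>. (U \<omega>)\<^sup>2 \<partial>M) * (\<integral>\<omega>. (V \<omega>)\<^sup>2 \<partial>M))\<bar>)"

text \<open>Here \<open>X i j\<close> is the \<open>j\<close>-th coordinate of the \<open>i\<close>-th observation.\<close>

definition max_moment ::
  "'a measure \<Rightarrow> nat \<Rightarrow> nat \<Rightarrow> (nat \<Rightarrow> nat \<Rightarrow> 'a \<Rightarrow> real) \<Rightarrow> (nat \<Rightarrow> real) \<Rightarrow> nat \<Rightarrow> real" where
  "max_moment M n p X \<mu> r = (MAX (i, j)\<in>{1..n} \<times> {1..p}. \<integral>\<omega>. (X i j \<omega> - \<mu> j) ^ r \<partial>M)"

definition min_moment ::
  "'a measure \<Rightarrow> nat \<Rightarrow> nat \<Rightarrow> (nat \<Rightarrow> nat \<Rightarrow> 'a \<Rightarrow> real) \<Rightarrow> (nat \<Rightarrow> real) \<Rightarrow> nat \<Rightarrow> real" where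
  "min_moment M n p X \<mu> r = (MIN (i, j)\<in>{1..n} \<times> {1..p}. \<integral>\<omega>. (X i j \<omega> - \<mu> j) ^ r \<partial>M)"

definition block_sum :: "(nat \<Rightarrow> nat \<Rightarrow> 'a \<Rightarrow> real) \<Rightarrow> nat set \<Rightarrow> nat \<Rightarrow> 'a \<Rightarrow> real" where
  "block_sum X A i \<omega> = (\<Sum>j\<in>A. X i j \<omega>)"

definition sigma_hat :: "nat \<Rightarrow> (nat \<Rightarrow> 'a \<Rightarrow> real) \<Rightarrow> 'a \<Rightarrow> real" where
  "sigma_hat n Y \<omega> = 1 / real n * (\<Sum>i=1..n. (Y i \<omega> - 1 / real n * (\<Sum>k=1..n. Y k \<omega>))\<^sup>2)"

text \<open>
  Since \<open>x / 0 = 0\<close>, the two ratios below vanish when \<open>sigma_hat\<close> is zero, which is the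
  intended convention.
\<close>
definition t_stat :: "nat \<Rightarrow> (nat \<Rightarrow> 'a \<Rightarrow> real) \<Rightarrow> 'a \<Rightarrow> real" where
  "t_stat n Y \<omega> = (\<Sum>i=1..n. Y i \<omega>) / sqrt (real n * sigma_hat n Y \<omega>)"

definition t_boot :: "nat \<Rightarrow> (nat \<Rightarrow> 'a \<Rightarrow> real) \<Rightarrow> (nat \<Rightarrow> 'a \<Rightarrow> real) \<Rightarrow> 'a \<Rightarrow> real" where
  "t_boot n \<xi> Y \<omega> = (\<Sum>i=1..n. \<xi> i \<omega> * Y i \<omega>) / sqrt (real n * sigma_hat n Y \<omega>)"

definition max_stat ::
  "nat \<Rightarrow> nat \<Rightarrow> (nat \<Rightarrow> nat \<Rightarrow> 'a \<Rightarrow> real) \<Rightarrow> (nat \<Rightarrow> nat set) \<Rightarrow> 'a \<Rightarrow> real" where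
  "max_stat n d X S \<omega> = (MAX l\<in>{1..d}. \<bar>t_stat n (block_sum X (S l)) \<omega>\<bar>)"

definition max_boot ::
  "nat \<Rightarrow> nat \<Rightarrow> (nat \<Rightarrow> 'a \<Rightarrow> real) \<Rightarrow> (nat \<Rightarrow> nat \<Rightarrow> 'a \<Rightarrow> real) \<Rightarrow> (nat \<Rightarrow> nat set) \<Rightarrow> 'a \<Rightarrow> real" where
  "max_boot n d \<xi> X S \<omega> = (MAX l\<in>{1..d}. \<bar>t_boot n \<xi> (block_sum X (S l)) \<omega>\<bar>)"

definition data_sigma :: "'a measure \<Rightarrow> nat \<Rightarrow> nat \<Rightarrow> (nat \<Rightarrow> nat \<Rightarrow> 'a \<Rightarrow> real) \<Rightarrow> 'a measure" where
  "data_sigma M n p X = gen_sigma M ({1..n} \<times> {1..p}) (\<lambda>(i, j). X i j)"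

text \<open>
  \<open>K\<close> is a regular conditional distribution of the real random variable \<open>W\<close> given the
  sub-sigma-algebra \<open>F\<close>. Such a kernel exists and is unique up to a null set, so that the
  conditional quantile \<open>\<lambda>\<omega>. quantile (K \<omega>) \<beta>\<close> is well defined almost surely.
\<close>
definition is_cond_distr ::
  "'a measure \<Rightarrow> 'a measure \<Rightarrow> ('a \<Rightarrow> real) \<Rightarrow> ('a \<Rightarrow> real measure) \<Rightarrow> bool" where
  "is_cond_distr M F W K \<longleftrightarrow>
     K \<in> measurable F (prob_algebra borel) \<and>
     (\<forall>B\<in>sets borel.
        AE \<omega> in M. measure (K \<omega>) B = real_cond_exp M F (\<lambda>x. indicator B (W x)) \<omega>)"

definition quantile :: "real measure \<Rightarrow> real \<Rightarrow> real" where
  "quantile N \<beta> = Inf {t. measure N {..t} \<ge> \<beta>}"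

end

theory Submission
  imports Defs
begin

text \<open>
  The bootstrap sums are not recentred, so given the data each bootstrap statistic is Gaussian
  with variance \<open>1 + T\<^sup>2 / n\<close>, where \<open>T\<close> is the corresponding statistic. A union bound gives
  \<open>c_alpha\<^sup>2 \<le> (1 + M\<^sup>2 / n) * L\<close> with \<open>L = 2 ln (2 d / alpha)\<close> and \<open>M\<close> the maximum, and since
  \<open>L = o(n)\<close> the test rejects as soon as \<open>M\<^sup>2 > 2 L\<close>. It therefore suffices to control the single
  statistic that attains the maximum in the local alternative. There Chebyshev's inequality is
  applied to the sample mean and to the sample second moment. The variance of the latter is
  governed by the fourth moment of a block sum, which mixing and boundedness bound by a
  multiple of \<open>q s + q\<^sup>2 s\<^sup>2\<close>, with \<open>s\<close> the maximal variance: expand the power and split every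
  quadruple of coordinates at its largest gap. The lower variance bound enters only to exclude
  a degenerate studentization.
\<close>

subsection \<open>Maximal correlation\<close>

text \<open>The maximum \<open>M\<close> stands on both sides of the comparison with the critical
  value, because a large studentized mean also inflates the conditional bootstrap variance. The
  comparison closes since the bound on \<open>c_alpha\<close> grows in \<open>M\<close> at most with
  slope \<open>sqrt (L / n)\<close>, which tends to zero. The threshold is of order
  \<open>ln d\<close>, as \<open>d >= 2\<close> lets \<open>ln d\<close> absorb the contribution of
  \<alpha>, while the squared signal is of order \<open>lambda * ln d\<close>; the divergence of
  \<open>lambda\<close> beats every constant. The shape of the fourth moment bound is dictated by
  the rates. Divided by \<open>n\<close> times the square of the lower variance bound
  \<open>c * q * s_min\<close>, it leaves multiples of \<open>s_max / (n * q * s_min^2)\<close> and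
  \<open>(s_max / s_min)^2 / n\<close>, and both vanish. Boundedness alone would give order
  \<open>q^4\<close>, which these rates do not control. The factor \<open>s\<close> in the part
  linear in \<open>q\<close> must be kept as well, because \<open>s_min\<close> may tend to
  zero.\<close>

lemma space_gen_sigma [simp]: "space (gen_sigma M I Z) = space M"
  by (simp add: gen_sigma_def space_measure_of_conv)

lemma sets_gen_sigma:
  "sets (gen_sigma M I Z)
     = sigma_sets (space M) (\<Union>j\<in>I. {Z j -` B \<inter> space M | B. B \<in> sets borel})"
  unfolding gen_sigma_def by (rule sets_measure_of) auto

lemma measurable_gen_sigma:
  assumes "j \<in> I"
  shows "Z j \<in> borel_measurable (gen_sigma M I Z)"
  by (rule measurableI) (use assms in \<open>auto simp: sets_gen_sigma\<close>)

lemma subalgebra_gen_sigma: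
  assumes "\<And>j. j \<in> I \<Longrightarrow> Z j \<in> borel_measurable M"
  shows "subalgebra M (gen_sigma M I Z)"
  unfolding subalgebra_def
proof (intro conjI)
  show "sets (gen_sigma M I Z) \<subseteq> sets M"
    unfolding sets_gen_sigma
    by (rule sets.sigma_sets_subset) (use assms in \<open>auto intro: measurable_sets\<close>)
qed simp

context prob_space
begin

lemma integrable_mult_L2:
  fixes U V :: "'a \<Rightarrow> real"
  assumes [measurable]: "U \<in> borel_measurable M" "V \<in> borel_measurable M"
    and "integrable M (\<lambda>x. (U x)\<^sup>2)" "integrable M (\<lambda>x. (V x)\<^sup>2)"
  shows "integrable M (\<lambda>x. U x * V x)"
proof (rule Bochner_Integration.integrable_bound)
  show "integrable M (\<lambda>x. (U x)\<^sup>2 + (V x)\<^sup>2)"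
    using assms by auto
  show "AE x in M. norm (U x * V x) \<le> norm ((U x)\<^sup>2 + (V x)\<^sup>2)"
  proof (rule AE_I2)
    fix x
    have "0 \<le> (\<bar>U x\<bar> - \<bar>V x\<bar>)\<^sup>2" by simp
    then have "2 * \<bar>U x * V x\<bar> \<le> (U x)\<^sup>2 + (V x)\<^sup>2"
      by (simp add: power2_diff abs_mult)
    then show "norm (U x * V x) \<le> norm ((U x)\<^sup>2 + (V x)\<^sup>2)" by simp
  qed
qed measurable

text \<open>The quadratic in \<open>t\<close> given by the second moment of \<open>t * U + V\<close>
  is never negative, so its value at the minimiser \<open>- b / a\<close> bounds the
  discriminant.\<close>

lemma expectation_Cauchy_Schwarz:
  fixes U V :: "'a \<Rightarrow> real"
  assumes [measurable]: "U \<in> borel_measurable M" "V \<in> borel_measurable M"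
    and i: "integrable M (\<lambda>x. (U x)\<^sup>2)" "integrable M (\<lambda>x. (V x)\<^sup>2)"
  shows "\<bar>expectation (\<lambda>x. U x * V x)\<bar>
           \<le> sqrt (expectation (\<lambda>x. (U x)\<^sup>2) * expectation (\<lambda>x. (V x)\<^sup>2))"
proof -
  note iUV = integrable_mult_L2[OF assms]
  define a where "a = expectation (\<lambda>x. (U x)\<^sup>2)"
  define b where "b = expectation (\<lambda>x. U x * V x)"
  define c where "c = expectation (\<lambda>x. (V x)\<^sup>2)"
  have ac: "0 \<le> a" "0 \<le> c" by (simp_all add: a_def c_def)
  have q: "0 \<le> a * t\<^sup>2 + 2 * b * t + c" for t
  proof -
    have "0 \<le> expectation (\<lambda>x. (t * U x + V x)\<^sup>2)" by simp
    also have "(\<lambda>x. (t * U x + V x)\<^sup>2)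
        = (\<lambda>x. t\<^sup>2 * (U x)\<^sup>2 + (2 * t) * (U x * V x) + (V x)\<^sup>2)"
      by (simp add: fun_eq_iff power2_eq_square algebra_simps)
    also have "expectation \<dots> = t\<^sup>2 * a + 2 * t * b + c"
      using i iUV by (simp add: a_def b_def c_def)
    finally show ?thesis by (simp add: algebra_simps)
  qed
  have "b\<^sup>2 \<le> a * c"
  proof (cases "a = 0")
    case True
    have "b = 0"
    proof (rule ccontr)
      assume "b \<noteq> 0"
      \<comment> \<open>With \<open>a = 0\<close> the quadratic is affine, and this argument gives
        it the value -1.\<close>
      with q[of "- (c + 1) / (2 * b)"] True show False by simp
    qed
    then show ?thesis using True by simp
  next
    case False
    with ac have "a > 0" by simp
    have "0 \<le> a * (a * (- b / a)\<^sup>2 + 2 * b * (- b / a) + c)"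
      using q[of "- b / a"] \<open>a > 0\<close> by (intro mult_nonneg_nonneg) auto
    also have "\<dots> = a * c - b\<^sup>2"
      using \<open>a > 0\<close> by (simp add: field_simps power2_eq_square)
    finally show ?thesis by simp
  qed
  then show ?thesis
    unfolding a_def[symmetric] b_def[symmetric] c_def[symmetric] by (rule real_le_rsqrt[of "\<bar>b\<bar>", simplified])
qed

lemma covar_eq:
  fixes U V :: "'a \<Rightarrow> real"
  assumes [measurable]: "U \<in> borel_measurable M" "V \<in> borel_measurable M"
    and i: "integrable M (\<lambda>x. (U x)\<^sup>2)" "integrable M (\<lambda>x. (V x)\<^sup>2)"
  shows "covar M U V = expectation (\<lambda>x. U x * V x) - expectation U * expectation V"
proof -
  have int: "integrable M U" "integrable M V" "integrable M (\<lambda>x. U x * V x)"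
    using square_integrable_imp_integrable[OF assms(1) i(1)]
      square_integrable_imp_integrable[OF assms(2) i(2)] integrable_mult_L2[OF assms] by auto
  define a b where "a = expectation U" and "b = expectation V"
  have "covar M U V = expectation (\<lambda>x. U x * V x - b * U x - a * V x + a * b)"
    unfolding covar_def a_def[symmetric] b_def[symmetric]
    by (intro Bochner_Integration.integral_cong) (auto simp: algebra_simps)
  also have "\<dots> = expectation (\<lambda>x. U x * V x) - a * b"
    using int by (simp add: prob_space a_def b_def)
  finally show ?thesis by (simp add: a_def b_def)
qed

lemma variance_le_second_moment:
  fixes U :: "'a \<Rightarrow> real"
  assumes [measurable]: "U \<in> borel_measurable M" and i: "integrable M (\<lambda>x. (U x)\<^sup>2)"
  shows "variance U \<le> expectation (\<lambda>x. (U x)\<^sup>2)"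
  using variance_eq[OF square_integrable_imp_integrable[OF assms] i] by simp

text \<open>Centring only lowers second moments, so Cauchy-Schwarz survives the uncentred
  normalisation of \<open>rho_mixing\<close>. Every quotient there is therefore at most 1, and a
  vanishing normaliser forces a vanishing covariance.\<close>

lemma abs_covar_le:
  fixes U V :: "'a \<Rightarrow> real"
  assumes [measurable]: "U \<in> borel_measurable M" "V \<in> borel_measurable M"
    and i: "integrable M (\<lambda>x. (U x)\<^sup>2)" "integrable M (\<lambda>x. (V x)\<^sup>2)"
  shows "\<bar>covar M U V\<bar> \<le> sqrt (expectation (\<lambda>x. (U x)\<^sup>2) * expectation (\<lambda>x. (V x)\<^sup>2))"
proof -
  have int: "integrable M U" "integrable M V"
    using square_integrable_imp_integrable[OF assms(1) i(1)]
      square_integrable_imp_integrable[OF assms(2) i(2)] by auto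
  have sq: "integrable M (\<lambda>x. (W x - a)\<^sup>2)"
    if "integrable M W" "integrable M (\<lambda>x. (W x)\<^sup>2)" for W :: "'a \<Rightarrow> real" and a
    using that by (simp add: power2_diff)
  have "\<bar>covar M U V\<bar> \<le> sqrt (variance U * variance V)"
    unfolding covar_def by (rule expectation_Cauchy_Schwarz) (use sq int i in auto)
  also have "\<dots> \<le> sqrt (expectation (\<lambda>x. (U x)\<^sup>2) * expectation (\<lambda>x. (V x)\<^sup>2))"
    by (intro real_sqrt_le_mono mult_mono variance_le_second_moment i) auto
  finally show ?thesis .
qed

text \<open>A real-valued supremum dominates its members only if the family is bounded above. The
  bound 1 supplies this for the inner supremum, the finite range of \<open>k\<close> for the outer
  one. Pairs with vanishing normaliser lie outside the suprema and are treated separately.\<close>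

lemma abs_covar_le_rho_mixing:
  assumes X: "\<And>j. j \<in> {1..p} \<Longrightarrow> X j \<in> borel_measurable M"
    and km: "1 \<le> k" "k + m \<le> p"
    and U: "U \<in> borel_measurable (gen_sigma M {1..k} X)"
    and V: "V \<in> borel_measurable (gen_sigma M {k + m..p} X)"
    and i: "integrable M (\<lambda>x. (U x)\<^sup>2)" "integrable M (\<lambda>x. (V x)\<^sup>2)"
  shows "\<bar>covar M U V\<bar>
           \<le> rho_mixing M p X m * sqrt (expectation (\<lambda>x. (U x)\<^sup>2) * expectation (\<lambda>x. (V x)\<^sup>2))"
proof -
  let ?L = "\<lambda>k. L2_nonzero M (gen_sigma M {1..k} X) \<times> L2_nonzero M (gen_sigma M {k + m..p} X)"
  let ?f = "\<lambda>U V. \<bar>covar M U V / sqrt (expectation (\<lambda>x. (U x)\<^sup>2) * expectation (\<lambda>x. (V x)\<^sup>2))\<bar>"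
  have sub: "subalgebra M (gen_sigma M {1..k} X)" "subalgebra M (gen_sigma M {k + m..p} X)"
    if "k \<in> {1..p - m}" for k
    using that X by (auto intro!: subalgebra_gen_sigma)
  have k: "k \<in> {1..p - m}" using km by auto
  have U': "U \<in> borel_measurable M" and V': "V \<in> borel_measurable M"
    using measurable_from_subalg sub[OF k] U V by blast+
  let ?s = "sqrt (expectation (\<lambda>x. (U x)\<^sup>2) * expectation (\<lambda>x. (V x)\<^sup>2))"
  show ?thesis
  proof (cases "?s = 0")
    case True
    have "\<bar>covar M U V\<bar> \<le> 0" using abs_covar_le[OF U' V' i] unfolding True .
    then show ?thesis unfolding True by simp
  next
    case False
    then have "\<not> (AE x in M. U x = 0)" "\<not> (AE x in M. V x = 0)"
      using integral_nonneg_eq_0_iff_AE[OF i(1)] integral_nonneg_eq_0_iff_AE[OF i(2)] by auto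
    then have UV: "(U, V) \<in> ?L k"
      using U V i by (auto simp: L2_nonzero_def)
    have f1: "?f U V \<le> 1" if "k \<in> {1..p - m}" "(U, V) \<in> ?L k" for U V k
    proof -
      have "U \<in> borel_measurable M" "V \<in> borel_measurable M"
        using measurable_from_subalg sub[OF that(1)] that(2) by (auto simp: L2_nonzero_def)
      then have "\<bar>covar M U V\<bar>
          \<le> sqrt (expectation (\<lambda>x. (U x)\<^sup>2) * expectation (\<lambda>x. (V x)\<^sup>2))"
        using that by (intro abs_covar_le) (auto simp: L2_nonzero_def)
      moreover have "\<bar>c / r\<bar> \<le> 1" if "\<bar>c\<bar> \<le> r" for c r :: real
        using that by (cases "r = 0") auto
      ultimately show ?thesis by blast
    qed
    have "?f U V \<le> (SUP (U, V)\<in>?L k. ?f U V)"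
      using UV f1[OF k]
      by (intro cSUP_upper2[where x = "(U, V)"] bdd_aboveI2[where M = 1]) auto
    also have "\<dots> \<le> rho_mixing M p X m"
      unfolding rho_mixing_def
      by (rule cSUP_upper[OF k]) simp
    finally have le: "?f U V \<le> rho_mixing M p X m" .
    have "0 \<le> ?s" by simp
    with False have "?s > 0" by linarith
    moreover have "\<bar>c\<bar> \<le> \<rho> * r" if "r > 0" "\<bar>c / r\<bar> \<le> \<rho>" for c r \<rho> :: real
      using that by (simp add: divide_le_eq)
    ultimately show ?thesis using le by blast
  qed
qed

end

subsection \<open>Moments of sums under mixing\<close>

text \<open>The distance of two indices. Passing through the integers makes it symmetric, which
  truncated subtraction of naturals is not.\<close>

definition gap :: "nat \<Rightarrow> nat \<Rightarrow> nat" where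
  "gap i j = nat \<bar>int i - int j\<bar>"

lemma gap_commute: "gap i j = gap j i"
  by (simp add: gap_def)

lemma gap_eq_diff: "i \<le> j \<Longrightarrow> gap i j = j - i"
  by (simp add: gap_def)

text \<open>Distinct exponents select distinct terms of the geometric series, whatever the set
  \<open>A\<close> looks like.\<close>

lemma sum_power_inj_le:
  fixes \<tau> :: real
  assumes "0 \<le> \<tau>" "\<tau> < 1" "finite A" "inj_on f A"
  shows "(\<Sum>j\<in>A. \<tau> ^ f j) \<le> 1 / (1 - \<tau>)"
proof -
  have "(\<Sum>j\<in>A. \<tau> ^ f j) = (\<Sum>m\<in>f ` A. \<tau> ^ m)"
    by (simp add: sum.reindex[OF assms(4)])
  also have "\<dots> \<le> (\<Sum>m. \<tau> ^ m)"
    using assms by (intro sum_le_suminf) auto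
  also have "\<dots> = 1 / (1 - \<tau>)"
    using assms by (intro suminf_geometric) auto
  finally show ?thesis .
qed

text \<open>On either side of \<open>i\<close> the distance to \<open>i\<close> determines the
  index, so each side costs at most one geometric series.\<close>

lemma sum_power_gap_le:
  fixes \<tau> :: real
  assumes "0 \<le> \<tau>" "\<tau> < 1" "finite A"
  shows "(\<Sum>j\<in>A. \<tau> ^ gap i j) \<le> 2 / (1 - \<tau>)"
proof -
  have A: "A = {j\<in>A. j \<le> i} \<union> {j\<in>A. i < j}" by auto
  have "(\<Sum>j\<in>A. \<tau> ^ gap i j) = (\<Sum>j\<in>{j\<in>A. j \<le> i}. \<tau> ^ gap i j) + (\<Sum>j\<in>{j\<in>A. i < j}. \<tau> ^ gap i j)"
    by (subst A, rule sum.union_disjoint) (use assms in auto)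
  also have "\<dots> \<le> 1 / (1 - \<tau>) + 1 / (1 - \<tau>)"
    using assms by (intro add_mono sum_power_inj_le inj_onI) (auto simp: gap_def)
  finally show ?thesis by simp
qed

lemma sum_sum_power_gap_le:
  fixes \<tau> :: real
  assumes "0 \<le> \<tau>" "\<tau> < 1" "finite A"
  shows "(\<Sum>i\<in>A. \<Sum>j\<in>A. \<tau> ^ gap i j) \<le> real (card A) * (2 / (1 - \<tau>))"
proof -
  have "(\<Sum>i\<in>A. \<Sum>j\<in>A. \<tau> ^ gap i j) \<le> (\<Sum>i\<in>A. 2 / (1 - \<tau>))"
    by (intro sum_mono sum_power_gap_le assms)
  then show ?thesis by simp
qed

text \<open>The three adjacent transpositions generate all permutations of four positions. Entries
  are inserted one at a time: \<open>d\<close> into a sorted triple, then \<open>c\<close> into a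
  sorted pair.\<close>

lemma sorted4_wlog:
  fixes Q :: "'b::linorder \<Rightarrow> 'b \<Rightarrow> 'b \<Rightarrow> 'b \<Rightarrow> bool"
  assumes s1: "\<And>a b c d. Q a b c d \<Longrightarrow> Q b a c d"
    and s2: "\<And>a b c d. Q a b c d \<Longrightarrow> Q a c b d"
    and s3: "\<And>a b c d. Q a b c d \<Longrightarrow> Q a b d c"
    and sorted: "\<And>a b c d. a \<le> b \<Longrightarrow> b \<le> c \<Longrightarrow> c \<le> d \<Longrightarrow> Q a b c d"
  shows "Q a b c d"
proof -
  have 3: "Q a b c d" if "a \<le> b" "b \<le> c" for a b c d
  proof -
    consider "c \<le> d" | "b \<le> d" "d \<le> c" | "a \<le> d" "d \<le> b" | "d \<le> a"
      using that by fastforce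
    then show ?thesis
    proof cases
      case 1 then show ?thesis using that sorted by blast
    next
      case 2 then show ?thesis using that sorted[of a b d c] s3 by blast
    next
      case 3 then show ?thesis using that sorted[of a d b c] s2 s3 by blast
    next
      case 4 then show ?thesis using that sorted[of d a b c] s1 s2 s3 by blast
    qed
  qed
  have 2: "Q a b c d" if "a \<le> b" for a b c d
  proof -
    consider "b \<le> c" | "a \<le> c" "c \<le> b" | "c \<le> a"
      using that by fastforce
    then show ?thesis
    proof cases
      case 1 then show ?thesis using that 3 by blast
    next
      case 2 then show ?thesis using that 3[of a c b d] s2 by blast
    next
      case 3 then show ?thesis using that \<open>\<And>d c b a. \<lbrakk>a \<le> b; b \<le> c\<rbrakk> \<Longrightarrow> Q a b c d\<close>[of c a b d] s1 s2 by blast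
    qed
  qed
  show ?thesis
    using 2[of a b c d] 2[of b a c d] s1 by (meson linear)
qed

text \<open>
  The rate is written as a twelfth power so that a correlation decay in terms of the largest gap
  of a quadruple can be distributed over all pairwise gaps.
\<close>

locale mixing_row = prob_space +
  fixes p :: nat and x :: "nat \<Rightarrow> 'a \<Rightarrow> real" and B s \<tau> :: real
  assumes rv [measurable]: "\<And>j. j \<in> {1..p} \<Longrightarrow> x j \<in> borel_measurable M"
    and bounded: "\<And>j. j \<in> {1..p} \<Longrightarrow> AE \<omega> in M. \<bar>x j \<omega>\<bar> \<le> B"
    and B_nonneg: "0 \<le> B"
    and centred: "\<And>j. j \<in> {1..p} \<Longrightarrow> expectation (x j) = 0"
    and second_moment: "\<And>j. j \<in> {1..p} \<Longrightarrow> expectation (\<lambda>\<omega>. (x j \<omega>)\<^sup>2) \<le> s"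
    and s_nonneg: "0 \<le> s"
    and tau: "0 \<le> \<tau>" "\<tau> < 1"
    and mixing: "\<And>k m. 1 \<le> k \<Longrightarrow> 1 \<le> m \<Longrightarrow> k + m \<le> p \<Longrightarrow> rho_mixing M p x m \<le> \<tau> ^ (12 * m)"
begin

abbreviation past :: "nat \<Rightarrow> 'a measure" where "past k \<equiv> gen_sigma M {1..k} x"
abbreviation future :: "nat \<Rightarrow> 'a measure" where "future k \<equiv> gen_sigma M {k..p} x"

text \<open>Second moments are measured in units of \<open>s\<close>, so that their geometric mean
  keeps exactly one factor \<open>s\<close>; almost sure bounds of further coordinates enter through
  \<open>a\<close> and \<open>b\<close>.\<close>

lemma cov_bound:
  assumes km: "1 \<le> k" "k < l" "l \<le> p"
    and U: "U \<in> borel_measurable (past k)" and V: "V \<in> borel_measurable (future l)"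
    and i: "integrable M (\<lambda>x. (U x)\<^sup>2)" "integrable M (\<lambda>x. (V x)\<^sup>2)"
    and a: "0 \<le> a" "expectation (\<lambda>x. (U x)\<^sup>2) \<le> a\<^sup>2 * s" "expectation (\<lambda>x. (V x)\<^sup>2) \<le> b\<^sup>2 * s" "0 \<le> b"
  shows "\<bar>expectation (\<lambda>x. U x * V x) - expectation U * expectation V\<bar> \<le> \<tau> ^ (12 * (l - k)) * (a * b * s)"
proof -
  have U': "U \<in> borel_measurable M"
    by (rule measurable_from_subalg[OF subalgebra_gen_sigma U]) (use km rv in auto)
  have V': "V \<in> borel_measurable M"
    by (rule measurable_from_subalg[OF subalgebra_gen_sigma V]) (use km rv in auto)
  have "\<bar>covar M U V\<bar> \<le> rho_mixing M p x (l - k)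
      * sqrt (expectation (\<lambda>x. (U x)\<^sup>2) * expectation (\<lambda>x. (V x)\<^sup>2))"
    by (rule abs_covar_le_rho_mixing[where k = k]) (use assms rv in auto)
  also have "\<dots> \<le> \<tau> ^ (12 * (l - k)) * sqrt ((a\<^sup>2 * s) * (b\<^sup>2 * s))"
    using tau a s_nonneg by (intro mult_mono mixing[of k] real_sqrt_le_mono) (use km in auto)
  also have "sqrt ((a\<^sup>2 * s) * (b\<^sup>2 * s)) = sqrt ((a * b * s)\<^sup>2)"
    by (simp add: power_mult_distrib power2_eq_square ac_simps)
  also have "\<dots> = a * b * s" using a s_nonneg by simp
  finally show ?thesis using covar_eq[OF U' V' i] by simp
qed

lemma integrable_bounded:
  fixes f :: "'a \<Rightarrow> real"
  assumes "f \<in> borel_measurable M" "AE \<omega> in M. \<bar>f \<omega>\<bar> \<le> K"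
  shows "integrable M f"
  using assms by (intro integrable_const_bound) auto

lemma AE_bounded_mult:
  fixes f g :: "'a \<Rightarrow> real"
  assumes "AE \<omega> in M. \<bar>f \<omega>\<bar> \<le> K" "AE \<omega> in M. \<bar>g \<omega>\<bar> \<le> L"
  shows "AE \<omega> in M. \<bar>f \<omega> * g \<omega>\<bar> \<le> K * L"
  using assms by eventually_elim (auto simp: abs_mult intro!: mult_mono)

text \<open>The bounded factor is replaced by \<open>K\<close> and only \<open>g\<close> is kept in
  mean square. Applied repeatedly to a product of coordinates, this retains a factor
  \<open>s\<close> in place of another square of the bound.\<close>

lemma expectation_square_mult_le:
  fixes f g :: "'a \<Rightarrow> real"
  assumes [measurable]: "f \<in> borel_measurable M" "g \<in> borel_measurable M"
    and "AE \<omega> in M. \<bar>f \<omega>\<bar> \<le> K" "integrable M (\<lambda>\<omega>. (g \<omega>)\<^sup>2)" "expectation (\<lambda>\<omega>. (g \<omega>)\<^sup>2) \<le> v"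
  shows "integrable M (\<lambda>\<omega>. (f \<omega> * g \<omega>)\<^sup>2)" "expectation (\<lambda>\<omega>. (f \<omega> * g \<omega>)\<^sup>2) \<le> K\<^sup>2 * v"
proof -
  have le: "AE \<omega> in M. (f \<omega> * g \<omega>)\<^sup>2 \<le> K\<^sup>2 * (g \<omega>)\<^sup>2"
    using assms(3)
  proof eventually_elim
    case (elim \<omega>)
    then have "(f \<omega>)\<^sup>2 \<le> K\<^sup>2" by (simp add: abs_le_square_iff[symmetric])
    then show ?case by (simp add: power_mult_distrib mult_right_mono)
  qed
  show i: "integrable M (\<lambda>\<omega>. (f \<omega> * g \<omega>)\<^sup>2)"
  proof (rule Bochner_Integration.integrable_bound)
    show "integrable M (\<lambda>\<omega>. K\<^sup>2 * (g \<omega>)\<^sup>2)" using assms by simp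
    show "AE \<omega> in M. norm ((f \<omega> * g \<omega>)\<^sup>2) \<le> norm (K\<^sup>2 * (g \<omega>)\<^sup>2)"
      using le by eventually_elim auto
  qed measurable
  have "expectation (\<lambda>\<omega>. (f \<omega> * g \<omega>)\<^sup>2) \<le> expectation (\<lambda>\<omega>. K\<^sup>2 * (g \<omega>)\<^sup>2)"
    by (rule integral_mono_AE[OF i _ le]) (use assms in simp)
  also have "\<dots> \<le> K\<^sup>2 * v" using assms by (simp add: mult_left_mono)
  finally show "expectation (\<lambda>\<omega>. (f \<omega> * g \<omega>)\<^sup>2) \<le> K\<^sup>2 * v" .
qed

lemma integrable_square: "j \<in> {1..p} \<Longrightarrow> integrable M (\<lambda>\<omega>. (x j \<omega>)\<^sup>2)"
  using AE_bounded_mult[OF bounded bounded, of j j]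
  by (intro integrable_bounded[where K = "B * B"]) (auto simp: power2_eq_square)

lemma integrable_mult: "i \<in> {1..p} \<Longrightarrow> j \<in> {1..p} \<Longrightarrow> integrable M (\<lambda>\<omega>. x i \<omega> * x j \<omega>)"
  by (intro integrable_mult_L2 integrable_square rv)

lemma integrable_mult4:
  "i \<in> {1..p} \<Longrightarrow> j \<in> {1..p} \<Longrightarrow> k \<in> {1..p} \<Longrightarrow> l \<in> {1..p} \<Longrightarrow>
    integrable M (\<lambda>\<omega>. x i \<omega> * x j \<omega> * x k \<omega> * x l \<omega>)"
  by (rule integrable_bounded[OF _ AE_bounded_mult[OF AE_bounded_mult[OF AE_bounded_mult]]])
    (use bounded in auto)

lemma measurable_past: "j \<in> {1..k} \<Longrightarrow> x j \<in> borel_measurable (past k)"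
  by (rule measurable_gen_sigma)

lemma measurable_future: "j \<in> {k..p} \<Longrightarrow> x j \<in> borel_measurable (future k)"
  by (rule measurable_gen_sigma)

lemma expectation_mult2_sorted:
  assumes "1 \<le> i" "i \<le> j" "j \<le> p"
  shows "\<bar>expectation (\<lambda>\<omega>. x i \<omega> * x j \<omega>)\<bar> \<le> \<tau> ^ (12 * (j - i)) * s"
proof (cases "i = j")
  case True
  then show ?thesis using second_moment[of i] assms by (simp add: power2_eq_square[symmetric])
next
  case False
  have "\<bar>expectation (\<lambda>\<omega>. x i \<omega> * x j \<omega>) - expectation (x i) * expectation (x j)\<bar>
      \<le> \<tau> ^ (12 * (j - i)) * (1 * 1 * s)"
    by (rule cov_bound[of i])
      (use assms False in \<open>auto simp del: One_nat_def intro!: measurable_past measurable_future integrable_square second_moment\<close>)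
  then show ?thesis using assms centred[of i] by simp
qed

lemma power_gap_mono: "m \<le> n \<Longrightarrow> \<tau> ^ n \<le> \<tau> ^ m"
  using tau by (intro power_decreasing) auto

text \<open>The quadruple is split at its largest gap.\<close>

lemma expectation_mult4_sorted:
  assumes "1 \<le> i" "i \<le> j" "j \<le> k" "k \<le> l" "l \<le> p"
  shows "\<bar>expectation (\<lambda>\<omega>. x i \<omega> * x j \<omega> * x k \<omega> * x l \<omega>)\<bar>
    \<le> \<tau> ^ (4 * (l - i)) * (B\<^sup>2 * s) + \<tau> ^ ((j - i) + (l - k)) * s\<^sup>2"
proof -
  have mem: "i \<in> {1..p}" "j \<in> {1..p}" "k \<in> {1..p}" "l \<in> {1..p}" using assms by auto
  note [measurable] = mem[THEN rv]
  have nonneg: "0 \<le> \<tau> ^ ((j - i) + (l - k)) * s\<^sup>2" using tau by simp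
  have sq2: "integrable M (\<lambda>\<omega>. (x i \<omega> * x j \<omega>)\<^sup>2)" "expectation (\<lambda>\<omega>. (x i \<omega> * x j \<omega>)\<^sup>2) \<le> B\<^sup>2 * s"
    if "i \<in> {1..p}" "j \<in> {1..p}" for i j
    using expectation_square_mult_le[OF rv rv bounded integrable_square second_moment] that by auto
  have sq3: "integrable M (\<lambda>\<omega>. (x i \<omega> * (x j \<omega> * x k \<omega>))\<^sup>2)"
    "expectation (\<lambda>\<omega>. (x i \<omega> * (x j \<omega> * x k \<omega>))\<^sup>2) \<le> (B * B)\<^sup>2 * s"
    if "i \<in> {1..p}" "j \<in> {1..p}" "k \<in> {1..p}" for i j k
    using expectation_square_mult_le[OF rv[OF that(1)] borel_measurable_times[OF rv[OF that(2)] rv[OF that(3)]]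
        bounded[OF that(1)] sq2[OF that(2,3)]]
    by (simp_all add: power_mult_distrib mult.assoc power2_eq_square)
  let ?E = "\<lambda>f. expectation (\<lambda>\<omega>. f \<omega> :: real)"
  define g where "g = max (j - i) (max (k - j) (l - k))"
  \<comment> \<open>The three consecutive gaps sum to \<open>l - i\<close>, hence
    \<open>l - i <= 3 * g\<close>, and a third of the exponent 12 survives as a rate in the full
    span.\<close>
  have g: "\<tau> ^ (12 * g) \<le> \<tau> ^ (4 * (l - i))"
    by (rule power_gap_mono) (use assms in \<open>auto simp: g_def\<close>)
  have Bs: "0 \<le> B\<^sup>2 * s" using s_nonneg by simp
  have main: "\<bar>expectation (\<lambda>\<omega>. x i \<omega> * x j \<omega> * x k \<omega> * x l \<omega>)\<bar>
    \<le> \<tau> ^ (12 * g) * (B\<^sup>2 * s) + \<tau> ^ ((j - i) + (l - k)) * s\<^sup>2"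
  proof -
    consider "g = 0" | "g > 0" "g = l - k" | "g > 0" "g = j - i" | "g > 0" "g = k - j"
      unfolding g_def by linarith
    then show ?thesis
    proof cases
      case 1
      \<comment> \<open>All four indices coincide: no decay is available, and boundedness turns the
        fourth moment into \<open>B^2 * s\<close>.\<close>
      then have eq: "j = i" "k = i" "l = i" using assms by (auto simp: g_def)
      have "(\<lambda>\<omega>. x i \<omega> * x j \<omega> * x k \<omega> * x l \<omega>) = (\<lambda>\<omega>. (x i \<omega> * x i \<omega>)\<^sup>2)"
        unfolding eq by (simp add: power2_eq_square ac_simps)
      then show ?thesis using sq2[of i i] mem nonneg \<open>g = 0\<close> by simp
    next
      case 2
      \<comment> \<open>The largest gap isolates the last coordinate. As that coordinate is centred,
        the product of expectations vanishes and the covariance is the whole moment; isolating the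
        first coordinate is symmetric.\<close>
      have "\<bar>?E (\<lambda>\<omega>. (x i \<omega> * (x j \<omega> * x k \<omega>)) * x l \<omega>)
          - ?E (\<lambda>\<omega>. x i \<omega> * (x j \<omega> * x k \<omega>)) * ?E (x l)\<bar> \<le> \<tau> ^ (12 * (l - k)) * ((B * B) * 1 * s)"
        by (rule cov_bound[of k])
          (use 2 assms mem B_nonneg in \<open>auto simp del: One_nat_def intro!: measurable_past measurable_future
            integrable_square second_moment sq3 borel_measurable_times\<close>)
      then show ?thesis using 2 mem centred[of l] nonneg by (simp add: power2_eq_square mult.assoc)
    next
      case 3
      have "\<bar>?E (\<lambda>\<omega>. x i \<omega> * (x j \<omega> * (x k \<omega> * x l \<omega>)))
          - ?E (x i) * ?E (\<lambda>\<omega>. x j \<omega> * (x k \<omega> * x l \<omega>))\<bar> \<le> \<tau> ^ (12 * (j - i)) * (1 * (B * B) * s)"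
        by (rule cov_bound[of i])
          (use 3 assms mem B_nonneg in \<open>auto simp del: One_nat_def intro!: measurable_past measurable_future
            integrable_square second_moment sq3 borel_measurable_times\<close>)
      then show ?thesis using 3 mem centred[of i] nonneg by (simp add: power2_eq_square mult.assoc)
    next
      case 4
      have c: "\<bar>?E (\<lambda>\<omega>. (x i \<omega> * x j \<omega>) * (x k \<omega> * x l \<omega>))
          - ?E (\<lambda>\<omega>. x i \<omega> * x j \<omega>) * ?E (\<lambda>\<omega>. x k \<omega> * x l \<omega>)\<bar> \<le> \<tau> ^ (12 * (k - j)) * (B * B * s)"
        by (rule cov_bound[of j])
          (use 4 assms mem B_nonneg in \<open>auto simp del: One_nat_def intro!: measurable_past measurable_future
            sq2 borel_measurable_times\<close>)
      \<comment> \<open>A split in the middle leaves a product of two pair moments, which decays in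
        the outer gaps but not in the middle one. This is the origin of the \<open>s^2\<close>
        term.\<close>
      have "\<bar>?E (\<lambda>\<omega>. x i \<omega> * x j \<omega>) * ?E (\<lambda>\<omega>. x k \<omega> * x l \<omega>)\<bar>
          \<le> (\<tau> ^ (12 * (j - i)) * s) * (\<tau> ^ (12 * (l - k)) * s)"
        unfolding abs_mult using assms tau s_nonneg
        by (intro mult_mono expectation_mult2_sorted) auto
      also have "\<dots> = \<tau> ^ (12 * (j - i) + 12 * (l - k)) * s\<^sup>2"
        by (simp add: power_add power2_eq_square)
      also have "\<dots> \<le> \<tau> ^ ((j - i) + (l - k)) * s\<^sup>2"
        by (intro mult_right_mono power_gap_mono) auto
      finally have d: "\<bar>?E (\<lambda>\<omega>. x i \<omega> * x j \<omega>) * ?E (\<lambda>\<omega>. x k \<omega> * x l \<omega>)\<bar>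
          \<le> \<tau> ^ ((j - i) + (l - k)) * s\<^sup>2" .
      have "\<bar>e\<bar> \<le> r + t" if "\<bar>e - a\<bar> \<le> r" "\<bar>a\<bar> \<le> t" for e a r t :: real
        using that by linarith
      from this[OF c d] show ?thesis using 4 by (simp add: power2_eq_square mult.assoc)
    qed
  qed
  also have "\<dots> \<le> \<tau> ^ (4 * (l - i)) * (B\<^sup>2 * s) + \<tau> ^ ((j - i) + (l - k)) * s\<^sup>2"
    using g Bs by (intro add_right_mono mult_right_mono)
  finally show ?thesis .
qed

lemma expectation_mult2:
  assumes "i \<in> {1..p}" "j \<in> {1..p}"
  shows "\<bar>expectation (\<lambda>\<omega>. x i \<omega> * x j \<omega>)\<bar> \<le> s * \<tau> ^ gap i j"
proof -
  have *: "\<bar>expectation (\<lambda>\<omega>. x i \<omega> * x j \<omega>)\<bar> \<le> s * \<tau> ^ gap i j" if "1 \<le> i" "i \<le> j" "j \<le> p" for i j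
  proof -
    have "\<tau> ^ (12 * (j - i)) * s \<le> \<tau> ^ gap i j * s"
      using s_nonneg that by (intro mult_right_mono power_gap_mono) (auto simp: gap_eq_diff)
    then show ?thesis using expectation_mult2_sorted[OF that] by (simp add: mult.commute)
  qed
  show ?thesis
    using *[of i j] *[of j i] assms by (cases "i \<le> j") (auto simp: mult.commute gap_commute)
qed

text \<open>Passing from sorted to arbitrary quadruples needs a bound symmetric in the indices,
  hence all six gaps in the auxiliary bound and all three pairings. Afterwards the gaps to
  \<open>i\<close> are enough: for fixed \<open>i\<close> they make the sum over the other three
  indices converge.\<close>

lemma expectation_mult4:
  assumes "i \<in> {1..p}" "j \<in> {1..p}" "k \<in> {1..p}" "l \<in> {1..p}"
  shows "\<bar>expectation (\<lambda>\<omega>. x i \<omega> * x j \<omega> * x k \<omega> * x l \<omega>)\<bar>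
    \<le> B\<^sup>2 * s * (\<tau> ^ gap i j * \<tau> ^ gap i k * \<tau> ^ gap i l)
      + s\<^sup>2 * (\<tau> ^ gap i j * \<tau> ^ gap k l + \<tau> ^ gap i k * \<tau> ^ gap j l + \<tau> ^ gap i l * \<tau> ^ gap j k)"
proof -
  define Q where "Q i j k l \<longleftrightarrow> ({i, j, k, l} \<subseteq> {1..p} \<longrightarrow>
    \<bar>expectation (\<lambda>\<omega>. x i \<omega> * x j \<omega> * x k \<omega> * x l \<omega>)\<bar>
    \<le> \<tau> ^ (gap i j + gap i k + gap i l + gap j k + gap j l + gap k l) * (B\<^sup>2 * s)
      + s\<^sup>2 * (\<tau> ^ gap i j * \<tau> ^ gap k l + \<tau> ^ gap i k * \<tau> ^ gap j l + \<tau> ^ gap i l * \<tau> ^ gap j k))"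
    for i j k l
  have "Q i j k l"
  proof (rule sorted4_wlog[of Q])
    show "Q b a c d" if "Q a b c d" for a b c d
      using that unfolding Q_def by (simp add: gap_commute[of b a] insert_commute ac_simps)
    show "Q a c b d" if "Q a b c d" for a b c d
      using that unfolding Q_def by (simp add: gap_commute[of c b] insert_commute ac_simps)
    show "Q a b d c" if "Q a b c d" for a b c d
      using that unfolding Q_def by (simp add: gap_commute[of d c] insert_commute ac_simps)
    show "Q i j k l" if s: "i \<le> j" "j \<le> k" "k \<le> l" for i j k l
      unfolding Q_def
    proof
      assume "{i, j, k, l} \<subseteq> {1..p}"
      then have "\<bar>expectation (\<lambda>\<omega>. x i \<omega> * x j \<omega> * x k \<omega> * x l \<omega>)\<bar>
          \<le> \<tau> ^ (4 * (l - i)) * (B\<^sup>2 * s) + \<tau> ^ ((j - i) + (l - k)) * s\<^sup>2"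
        using s by (intro expectation_mult4_sorted) auto
      \<comment> \<open>With consecutive gaps \<open>a\<close>, \<open>b\<close>, \<open>c\<close>
        the six pairwise gaps sum to \<open>3 * a + 4 * b + 3 * c\<close>, which is at most
        \<open>4 * (l - i)\<close>. This factor 4 and the 3 from the largest gap make up the
        exponent 12.\<close>
      also have "\<tau> ^ (4 * (l - i)) * (B\<^sup>2 * s)
          \<le> \<tau> ^ (gap i j + gap i k + gap i l + gap j k + gap j l + gap k l) * (B\<^sup>2 * s)"
        using s s_nonneg by (intro mult_right_mono power_gap_mono) (auto simp: gap_eq_diff)
      also have "\<tau> ^ ((j - i) + (l - k)) * s\<^sup>2 = s\<^sup>2 * (\<tau> ^ gap i j * \<tau> ^ gap k l)"
        using s by (simp only: gap_eq_diff power_add mult.commute)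
      also have "\<dots> \<le> s\<^sup>2 * (\<tau> ^ gap i j * \<tau> ^ gap k l + \<tau> ^ gap i k * \<tau> ^ gap j l + \<tau> ^ gap i l * \<tau> ^ gap j k)"
        using tau by (intro mult_left_mono) auto
      finally show "\<bar>expectation (\<lambda>\<omega>. x i \<omega> * x j \<omega> * x k \<omega> * x l \<omega>)\<bar>
    \<le> \<tau> ^ (gap i j + gap i k + gap i l + gap j k + gap j l + gap k l) * (B\<^sup>2 * s)
      + s\<^sup>2 * (\<tau> ^ gap i j * \<tau> ^ gap k l + \<tau> ^ gap i k * \<tau> ^ gap j l + \<tau> ^ gap i l * \<tau> ^ gap j k)"
        by simp
    qed
  qed
  moreover have "\<tau> ^ (gap i j + gap i k + gap i l + gap j k + gap j l + gap k l) * (B\<^sup>2 * s)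
      \<le> \<tau> ^ (gap i j + gap i k + gap i l) * (B\<^sup>2 * s)"
    using s_nonneg by (intro mult_right_mono power_gap_mono) auto
  ultimately show ?thesis
    using assms by (simp add: Q_def power_add ac_simps)
qed

lemma second_moment_sum_le:
  assumes "A \<subseteq> {1..p}"
  shows "expectation (\<lambda>\<omega>. (\<Sum>j\<in>A. x j \<omega>)\<^sup>2) \<le> s * (real (card A) * (2 / (1 - \<tau>)))"
proof -
  have fin: "finite A" using assms finite_subset by blast
  have "expectation (\<lambda>\<omega>. (\<Sum>j\<in>A. x j \<omega>)\<^sup>2) = expectation (\<lambda>\<omega>. \<Sum>i\<in>A. \<Sum>j\<in>A. x i \<omega> * x j \<omega>)"
    by (simp add: power2_eq_square sum_product)
  also have "\<dots> = (\<Sum>i\<in>A. \<Sum>j\<in>A. expectation (\<lambda>\<omega>. x i \<omega> * x j \<omega>))"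
    using integrable_mult assms by (simp add: subset_iff)
  also have "\<dots> \<le> (\<Sum>i\<in>A. \<Sum>j\<in>A. s * \<tau> ^ gap i j)"
    using assms by (intro sum_mono order_trans[OF abs_ge_self expectation_mult2]) auto
  also have "\<dots> = s * (\<Sum>i\<in>A. \<Sum>j\<in>A. \<tau> ^ gap i j)"
    by (simp add: sum_distrib_left)
  also have "\<dots> \<le> s * (real (card A) * (2 / (1 - \<tau>)))"
    by (intro mult_left_mono sum_sum_power_gap_le tau fin s_nonneg)
  finally show ?thesis .
qed

text \<open>For fixed \<open>i\<close> the three gap factors sum separately and give a cube, so the
  \<open>B^2 * s\<close> part stays linear in the cardinality. Each of the three pairings factors
  into the square of the double gap sum.\<close>

lemma fourth_moment_sum_le:
  assumes "A \<subseteq> {1..p}"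
  shows "expectation (\<lambda>\<omega>. (\<Sum>j\<in>A. x j \<omega>) ^ 4)
    \<le> B\<^sup>2 * s * (real (card A) * (2 / (1 - \<tau>)) ^ 3) + 3 * s\<^sup>2 * (real (card A) * (2 / (1 - \<tau>)))\<^sup>2"
proof -
  define G where "G = 2 / (1 - \<tau>)"
  have G: "0 \<le> G" using tau by (simp add: G_def)
  have fin: "finite A" using assms finite_subset by blast
  let ?t = "\<lambda>i j. \<tau> ^ gap i j"
  let ?T = "\<Sum>i\<in>A. \<Sum>j\<in>A. ?t i j"
  have T: "0 \<le> ?T" "?T \<le> real (card A) * G"
    using sum_sum_power_gap_le[OF tau fin] tau by (auto simp: G_def intro!: sum_nonneg)
  have "expectation (\<lambda>\<omega>. (\<Sum>j\<in>A. x j \<omega>) ^ 4)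
      = expectation (\<lambda>\<omega>. \<Sum>i\<in>A. \<Sum>j\<in>A. \<Sum>k\<in>A. \<Sum>l\<in>A. x i \<omega> * x j \<omega> * x k \<omega> * x l \<omega>)"
    by (simp only: power4_eq_xxxx sum_distrib_left[symmetric] sum_distrib_right[symmetric])
  also have "\<dots> = (\<Sum>i\<in>A. \<Sum>j\<in>A. \<Sum>k\<in>A. \<Sum>l\<in>A. expectation (\<lambda>\<omega>. x i \<omega> * x j \<omega> * x k \<omega> * x l \<omega>))"
    using integrable_mult4 assms by (simp add: subset_iff)
  also have "\<dots> \<le> (\<Sum>i\<in>A. \<Sum>j\<in>A. \<Sum>k\<in>A. \<Sum>l\<in>A. B\<^sup>2 * s * (?t i j * ?t i k * ?t i l)
      + s\<^sup>2 * (?t i j * ?t k l + ?t i k * ?t j l + ?t i l * ?t j k))"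
    using assms by (intro sum_mono order_trans[OF abs_ge_self expectation_mult4]) auto
  also have "\<dots> = B\<^sup>2 * s * (\<Sum>i\<in>A. \<Sum>j\<in>A. \<Sum>k\<in>A. \<Sum>l\<in>A. ?t i j * ?t i k * ?t i l)
      + s\<^sup>2 * ((\<Sum>i\<in>A. \<Sum>j\<in>A. \<Sum>k\<in>A. \<Sum>l\<in>A. ?t i j * ?t k l)
        + (\<Sum>i\<in>A. \<Sum>j\<in>A. \<Sum>k\<in>A. \<Sum>l\<in>A. ?t i k * ?t j l)
        + (\<Sum>i\<in>A. \<Sum>j\<in>A. \<Sum>k\<in>A. \<Sum>l\<in>A. ?t i l * ?t j k))"
    by (simp only: sum.distrib sum_distrib_left[symmetric])
  also have "(\<Sum>i\<in>A. \<Sum>j\<in>A. \<Sum>k\<in>A. \<Sum>l\<in>A. ?t i j * ?t i k * ?t i l) = (\<Sum>i\<in>A. (\<Sum>j\<in>A. ?t i j) ^ 3)"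
    by (simp only: power3_eq_cube sum_distrib_left[symmetric] sum_distrib_right[symmetric])
  also have "(\<Sum>i\<in>A. \<Sum>j\<in>A. \<Sum>k\<in>A. \<Sum>l\<in>A. ?t i j * ?t k l) = ?T * ?T"
    by (simp add: sum_distrib_left[symmetric] sum_distrib_right[symmetric])
  also have "(\<Sum>i\<in>A. \<Sum>j\<in>A. \<Sum>k\<in>A. \<Sum>l\<in>A. ?t i k * ?t j l) = ?T * ?T"
    by (simp add: sum_product)
  also have "(\<Sum>i\<in>A. \<Sum>j\<in>A. \<Sum>k\<in>A. \<Sum>l\<in>A. ?t i l * ?t j k)
      = (\<Sum>i\<in>A. \<Sum>j\<in>A. \<Sum>l\<in>A. \<Sum>k\<in>A. ?t i l * ?t j k)"
    by (rule sum.cong[OF refl], rule sum.cong[OF refl], rule sum.swap)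
  also have "\<dots> = ?T * ?T"
    by (simp add: sum_product)
  also have "B\<^sup>2 * s * (\<Sum>i\<in>A. (\<Sum>j\<in>A. ?t i j) ^ 3) + s\<^sup>2 * (?T * ?T + ?T * ?T + ?T * ?T)
      \<le> B\<^sup>2 * s * (\<Sum>i\<in>A. G ^ 3) + s\<^sup>2 * (3 * (real (card A) * G)\<^sup>2)"
  proof (intro add_mono mult_left_mono sum_mono power_mono)
    show "(\<Sum>j\<in>A. ?t i j) \<le> G" for i
      unfolding G_def by (rule sum_power_gap_le[OF tau fin])
    show "0 \<le> (\<Sum>j\<in>A. ?t i j)" for i using tau by (intro sum_nonneg) auto
    have "?T\<^sup>2 \<le> (real (card A) * G)\<^sup>2" using T by (intro power_mono)
    then show "?T * ?T + ?T * ?T + ?T * ?T \<le> 3 * (real (card A) * G)\<^sup>2"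
      by (simp add: power2_eq_square)
  qed (use s_nonneg in auto)
  finally show ?thesis by (simp add: G_def)
qed

end

subsection \<open>Concentration of the studentized statistic\<close>

context prob_space
begin

text \<open>Bienayme's identity by induction: the new summand is centred and independent of the
  partial sum, so the cross term integrates to zero. Integrability is carried along because the
  induction step splits the integral.\<close>

lemma expectation_square_sum_indep:
  fixes W :: "'i \<Rightarrow> 'a \<Rightarrow> real"
  assumes "finite I" "indep_vars (\<lambda>_. borel) W I"
    and "\<And>i. i \<in> I \<Longrightarrow> integrable M (\<lambda>\<omega>. (W i \<omega>)\<^sup>2)"
    and "\<And>i. i \<in> I \<Longrightarrow> expectation (W i) = 0"
  shows "integrable M (\<lambda>\<omega>. (\<Sum>i\<in>I. W i \<omega>)\<^sup>2)
    \<and> expectation (\<lambda>\<omega>. (\<Sum>i\<in>I. W i \<omega>)\<^sup>2) = (\<Sum>i\<in>I. expectation (\<lambda>\<omega>. (W i \<omega>)\<^sup>2))"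
  using assms
proof (induction I rule: finite_induct)
  case (insert i I)
  have rv: "W j \<in> borel_measurable M" if "j \<in> insert i I" for j
    using that insert.prems(1) by (auto simp: indep_vars_def)
  have int: "integrable M (W j)" if "j \<in> insert i I" for j
    using square_integrable_imp_integrable[OF rv[OF that] insert.prems(2)[OF that]] .
  let ?T = "\<lambda>\<omega>. \<Sum>j\<in>I. W j \<omega>"
  have rvT: "?T \<in> borel_measurable M" using rv by (intro borel_measurable_sum) auto
  have IH: "integrable M (\<lambda>\<omega>. (?T \<omega>)\<^sup>2)"
    "expectation (\<lambda>\<omega>. (?T \<omega>)\<^sup>2) = (\<Sum>j\<in>I. expectation (\<lambda>\<omega>. (W j \<omega>)\<^sup>2))"
    using insert.IH insert.prems indep_vars_subset[OF insert.prems(1), of I] by auto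
  have intT: "integrable M ?T" using int by auto
  have ind: "indep_var borel (W i) borel ?T"
    by (rule indep_vars_sum[OF insert.hyps(1,2) insert.prems(1)])
  have iWT: "integrable M (\<lambda>\<omega>. W i \<omega> * ?T \<omega>)"
    by (rule indep_var_integrable[OF ind int intT]) simp
  have "expectation (\<lambda>\<omega>. W i \<omega> * ?T \<omega>) = expectation (W i) * expectation ?T"
    by (rule indep_var_lebesgue_integral[OF ind int intT]) simp
  then have 0: "expectation (\<lambda>\<omega>. W i \<omega> * ?T \<omega>) = 0" using insert.prems(3)[of i] by simp
  have eq: "(\<lambda>\<omega>. (\<Sum>j\<in>insert i I. W j \<omega>)\<^sup>2) = (\<lambda>\<omega>. (W i \<omega>)\<^sup>2 + 2 * (W i \<omega> * ?T \<omega>) + (?T \<omega>)\<^sup>2)"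
    using insert.hyps by (simp add: power2_sum fun_eq_iff algebra_simps)
  have iW: "integrable M (\<lambda>\<omega>. (W i \<omega>)\<^sup>2)" using insert.prems(2) by simp
  show ?case
    unfolding eq using iW iWT IH 0 insert.hyps by simp
qed simp

text \<open>Each summand is recentred at its own mean, as the summands need not be identically
  distributed; only the total variance enters.\<close>

lemma Chebyshev_sum_indep:
  fixes Z :: "'i \<Rightarrow> 'a \<Rightarrow> real"
  assumes I: "finite I" and ind: "indep_vars (\<lambda>_. borel) Z I"
    and int: "\<And>i. i \<in> I \<Longrightarrow> integrable M (\<lambda>\<omega>. (Z i \<omega>)\<^sup>2)"
    and v: "(\<Sum>i\<in>I. variance (Z i)) \<le> v" and a: "0 < a"
  shows "prob {\<omega>\<in>space M. a \<le> \<bar>(\<Sum>i\<in>I. Z i \<omega>) - (\<Sum>i\<in>I. expectation (Z i))\<bar>} \<le> v / a\<^sup>2"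
proof -
  have rv[measurable]: "Z j \<in> borel_measurable M" if "j \<in> I" for j
    using that ind by (auto simp: indep_vars_def)
  have int1: "integrable M (Z j)" if "j \<in> I" for j
    using square_integrable_imp_integrable[OF rv[OF that] int[OF that]] .
  define W where "W i \<omega> = Z i \<omega> - expectation (Z i)" for i \<omega>
  have "indep_vars (\<lambda>_. borel) W I"
    unfolding W_def using indep_vars_compose2[OF ind, of "\<lambda>i z. z - expectation (Z i)" "\<lambda>_. borel"] by simp
  moreover have "integrable M (\<lambda>\<omega>. (W i \<omega>)\<^sup>2)" "expectation (W i) = 0" if "i \<in> I" for i
    using int[OF that] int1[OF that] by (auto simp: W_def[abs_def] power2_diff prob_space)
  ultimately have "integrable M (\<lambda>\<omega>. (\<Sum>i\<in>I. W i \<omega>)\<^sup>2)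
      \<and> expectation (\<lambda>\<omega>. (\<Sum>i\<in>I. W i \<omega>)\<^sup>2) = (\<Sum>i\<in>I. expectation (\<lambda>\<omega>. (W i \<omega>)\<^sup>2))"
    by (intro expectation_square_sum_indep[OF I])
  then have sq: "integrable M (\<lambda>\<omega>. (\<Sum>i\<in>I. W i \<omega>)\<^sup>2)"
    "expectation (\<lambda>\<omega>. (\<Sum>i\<in>I. W i \<omega>)\<^sup>2) = (\<Sum>i\<in>I. variance (Z i))"
    by (simp_all add: W_def[abs_def])
  have "prob {\<omega>\<in>space M. a \<le> \<bar>\<Sum>i\<in>I. W i \<omega>\<bar>} \<le> expectation (\<lambda>\<omega>. (\<Sum>i\<in>I. W i \<omega>)\<^sup>2) / a\<^sup>2"
    by (rule second_moment_method) (use sq a in \<open>auto simp: W_def\<close>)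
  also have "\<dots> \<le> v / a\<^sup>2" unfolding sq(2) by (rule divide_right_mono[OF v]) simp
  finally show ?thesis by (simp add: W_def sum_subtractf)
qed

end

text \<open>The empirical variance may be computed around any centre, at the cost of the squared
  deviation of the sample mean. The true mean is the centre suited to concentration, zero the one
  suited to the uncentred bootstrap weights.\<close>

lemma sigma_hat_eq:
  assumes "n \<ge> 1"
  shows "sigma_hat n Y \<omega> = (\<Sum>i=1..n. (Y i \<omega> - m)\<^sup>2) / real n - ((\<Sum>i=1..n. Y i \<omega>) / real n - m)\<^sup>2"
proof -
  define a where "a = 1 / real n * (\<Sum>k=1..n. Y k \<omega>)"
  have sa: "(\<Sum>k=1..n. Y k \<omega>) = real n * a" using assms by (simp add: a_def)
  have "(\<Sum>i=1..n. (Y i \<omega> - a)\<^sup>2) = (\<Sum>i=1..n. (Y i \<omega> - m)\<^sup>2 - 2 * (a - m) * (Y i \<omega>) + (a\<^sup>2 - m\<^sup>2))"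
    by (intro sum.cong) (auto simp: power2_eq_square algebra_simps)
  also have "\<dots> = (\<Sum>i=1..n. (Y i \<omega> - m)\<^sup>2) - 2 * (a - m) * (real n * a) + real n * (a\<^sup>2 - m\<^sup>2)"
    unfolding sum.distrib sum_subtractf sum_distrib_left[symmetric] sa by (simp add: algebra_simps)
  also have "\<dots> = (\<Sum>i=1..n. (Y i \<omega> - m)\<^sup>2) - real n * (a - m)\<^sup>2"
    by (simp add: power2_eq_square algebra_simps)
  finally show ?thesis
    unfolding sigma_hat_def a_def[symmetric] sa using assms by (simp add: field_simps)
qed

lemma sigma_hat_nonneg: "0 \<le> sigma_hat n Y \<omega>"
  by (simp add: sigma_hat_def sum_nonneg)

text \<open>The deterministic part. Hypotheses \<open>1\<close> and \<open>2\<close> keep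
  \<open>sigma_hat\<close> between \<open>V / 4\<close> and \<open>3 * V / 2\<close>, so the default
  value 0 of the ratio never intervenes; \<open>3\<close> keeps the sum at least half as large as
  \<open>n * m\<close> in modulus. Dividing \<open>n^2 * m^2 / 4\<close> by
  \<open>n * (3 * V / 2)\<close> produces the 6.\<close>

lemma t_stat_square_ge:
  assumes n: "n \<ge> 1" and V: "V > 0"
    and 1: "\<bar>(\<Sum>i=1..n. (Y i \<omega> - m)\<^sup>2) - real n * V\<bar> < real n * V / 2"
    and 2: "\<bar>(\<Sum>i=1..n. Y i \<omega>) - real n * m\<bar> < real n * sqrt V / 2"
    and 3: "\<bar>(\<Sum>i=1..n. Y i \<omega>) - real n * m\<bar> < real n * \<bar>m\<bar> / 2"
  shows "real n * m\<^sup>2 / (6 * V) \<le> (t_stat n Y \<omega>)\<^sup>2"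
proof -
  define S where "S = (\<Sum>i=1..n. Y i \<omega>)"
  define Q where "Q = (\<Sum>i=1..n. (Y i \<omega> - m)\<^sup>2)"
  define h where "h = sigma_hat n Y \<omega>"
  have n0: "real n > 0" using n by simp
  have h: "h = Q / real n - (S / real n - m)\<^sup>2"
    unfolding h_def S_def Q_def by (rule sigma_hat_eq[OF n])
  have "\<bar>S / real n - m\<bar> = \<bar>S - real n * m\<bar> / real n"
  proof -
    have "S / real n - m = (S - real n * m) / real n" using n0 by (simp add: field_simps)
    then show ?thesis using n0 by (simp add: abs_divide)
  qed
  also have "\<dots> < sqrt V / 2" using 2 n0 by (simp add: S_def field_simps)
  finally have "\<bar>S / real n - m\<bar>\<^sup>2 < (sqrt V / 2)\<^sup>2" by (intro power_strict_mono) auto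
  then have a: "(S / real n - m)\<^sup>2 < V / 4" using V by (simp add: power_divide)
  have b: "V / 2 < Q / real n" "Q / real n < 3 * V / 2"
  proof -
    have "real n * V / 2 < Q" "Q < 3 * (real n * V) / 2"
      using 1 unfolding Q_def[symmetric] by linarith+
    then show "V / 2 < Q / real n" "Q / real n < 3 * V / 2" using n0 by (auto simp: field_simps)
  qed
  have pos: "0 < sigma_hat n Y \<omega>" using a b V h h_def by linarith
  have h_le: "h \<le> 3 * V / 2" using b h by (smt (verit) zero_le_power2)
  have "real n * \<bar>m\<bar> / 2 \<le> \<bar>S\<bar>"
  proof -
    have "\<bar>real n * m\<bar> = real n * \<bar>m\<bar>" by (simp add: abs_mult)
    then show ?thesis using 3 unfolding S_def[symmetric] by linarith
  qed
  then have "(real n * \<bar>m\<bar> / 2)\<^sup>2 \<le> \<bar>S\<bar>\<^sup>2" by (intro power_mono) auto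
  then have S2: "(real n)\<^sup>2 * m\<^sup>2 / 4 \<le> S\<^sup>2" by (simp add: power_divide power_mult_distrib)
  have "real n * m\<^sup>2 / (6 * V) = ((real n)\<^sup>2 * m\<^sup>2 / 4) / (real n * (3 * V / 2))"
    using n0 V by (simp add: field_simps power2_eq_square)
  also have "\<dots> \<le> S\<^sup>2 / (real n * h)"
    by (intro frac_le S2) (use pos n0 h_le h_def in auto)
  also have "\<dots> = (t_stat n Y \<omega>)\<^sup>2"
    unfolding t_stat_def S_def[symmetric] h_def[symmetric] using pos n0 h_def
    by (simp add: power_divide)
  finally show "real n * m\<^sup>2 / (6 * V) \<le> (t_stat n Y \<omega>)\<^sup>2" .
qed

lemma borel_measurable_sigma_hat [measurable]:
  assumes [measurable]: "\<And>i. i \<in> {1..n} \<Longrightarrow> Y i \<in> borel_measurable M"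
  shows "sigma_hat n Y \<in> borel_measurable M"
  unfolding sigma_hat_def by measurable

lemma borel_measurable_t_stat [measurable]:
  assumes [measurable]: "\<And>i. i \<in> {1..n} \<Longrightarrow> Y i \<in> borel_measurable M"
  shows "t_stat n Y \<in> borel_measurable M"
  unfolding t_stat_def by measurable

text \<open>The three error terms are the Chebyshev bounds for the three deviations excluded in
  \<open>t_stat_square_ge\<close>, in the same order. \<open>V\<close> is an average variance, since
  the observations may have different laws.\<close>

lemma (in prob_space) prob_t_stat_large:
  fixes Y :: "nat \<Rightarrow> 'a \<Rightarrow> real"
  assumes n: "n \<ge> 1" and ind: "indep_vars (\<lambda>_. borel) Y {1..n}"
    and bdd: "\<And>i. i \<in> {1..n} \<Longrightarrow> AE \<omega> in M. \<bar>Y i \<omega>\<bar> \<le> K"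
    and mean: "\<And>i. i \<in> {1..n} \<Longrightarrow> expectation (Y i) = m"
    and V: "(\<Sum>i=1..n. variance (Y i)) = real n * V" "V > 0"
    and W: "\<And>i. i \<in> {1..n} \<Longrightarrow> expectation (\<lambda>\<omega>. (Y i \<omega> - m) ^ 4) \<le> W"
    and m: "m \<noteq> 0"
  shows "prob {\<omega>\<in>space M. real n * m\<^sup>2 / (6 * V) \<le> (t_stat n Y \<omega>)\<^sup>2}
     \<ge> 1 - (4 * W / (real n * V\<^sup>2) + 4 / real n + 4 * V / (real n * m\<^sup>2))"
proof -
  have n0: "real n > 0" using n by simp
  have rv[measurable]: "Y j \<in> borel_measurable M" if "j \<in> {1..n}" for j
    using that ind by (auto simp: indep_vars_def)
  have int: "integrable M (\<lambda>\<omega>. (Y i \<omega> - b) ^ k)" if "i \<in> {1..n}" for i b k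
  proof (rule integrable_const_bound)
    show "AE \<omega> in M. norm ((Y i \<omega> - b) ^ k) \<le> (K + \<bar>b\<bar>) ^ k"
      using bdd[OF that]
    proof eventually_elim
      case (elim \<omega>)
      show ?case unfolding norm_power by (rule power_mono) (use elim in auto)
    qed
  qed (use that in measurable)
  let ?Z = "\<lambda>i \<omega>. (Y i \<omega> - m)\<^sup>2"
  have indZ: "indep_vars (\<lambda>_. borel) ?Z {1..n}"
    using indep_vars_compose2[OF ind, of "\<lambda>i z. (z - m)\<^sup>2" "\<lambda>_. borel"] by simp
  have EZ: "(\<Sum>i=1..n. expectation (?Z i)) = real n * V"
    unfolding V(1)[symmetric] by (intro sum.cong refl) (simp add: mean)
  have EY: "(\<Sum>i=1..n. expectation (Y i)) = real n * m"
    by (simp add: mean)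
  define A1 where "A1 = {\<omega>\<in>space M. real n * V / 2 \<le> \<bar>(\<Sum>i=1..n. ?Z i \<omega>) - real n * V\<bar>}"
  define A2 where "A2 = {\<omega>\<in>space M. real n * sqrt V / 2 \<le> \<bar>(\<Sum>i=1..n. Y i \<omega>) - real n * m\<bar>}"
  define A3 where "A3 = {\<omega>\<in>space M. real n * \<bar>m\<bar> / 2 \<le> \<bar>(\<Sum>i=1..n. Y i \<omega>) - real n * m\<bar>}"
  define D where "D = {\<omega>\<in>space M. real n * m\<^sup>2 / (6 * V) \<le> (t_stat n Y \<omega>)\<^sup>2}"
  have [measurable]: "A1 \<in> sets M" "A2 \<in> sets M" "A3 \<in> sets M" "D \<in> sets M"
    unfolding A1_def A2_def A3_def D_def by measurable
  have "prob A1 \<le> (real n * W) / (real n * V / 2)\<^sup>2"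
    unfolding A1_def EZ[symmetric]
  proof (rule Chebyshev_sum_indep[OF _ indZ])
    have "variance (?Z i) \<le> W" if "i \<in> {1..n}" for i
    proof -
      have sq: "integrable M (\<lambda>\<omega>. (?Z i \<omega>)\<^sup>2)"
        using int[OF that, of m 4] by (simp add: power_mult[symmetric])
      have "variance (?Z i) \<le> expectation (\<lambda>\<omega>. (?Z i \<omega>)\<^sup>2)"
        by (rule variance_le_second_moment[OF _ sq]) (use that in measurable)
      also have "\<dots> \<le> W" using W[OF that] by (simp add: power_mult[symmetric])
      finally show ?thesis .
    qed
    then show "(\<Sum>i=1..n. variance (?Z i)) \<le> real n * W"
      using sum_mono[of "{1..n}" "\<lambda>i. variance (?Z i)" "\<lambda>_. W"] by simp
    show "integrable M (\<lambda>\<omega>. (?Z i \<omega>)\<^sup>2)" if "i \<in> {1..n}" for i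
      using int[OF that, of m 4] by (simp add: power_mult[symmetric])
  qed (use n0 V EZ in auto)
  also have "\<dots> = 4 * W / (real n * V\<^sup>2)"
    using n0 V by (simp add: field_simps power2_eq_square)
  finally have 1: "prob A1 \<le> 4 * W / (real n * V\<^sup>2)" .
  have cheb: "prob {\<omega>\<in>space M. real n * b / 2 \<le> \<bar>(\<Sum>i=1..n. Y i \<omega>) - real n * m\<bar>} \<le> 4 * V / (real n * b\<^sup>2)"
    if "b > 0" for b
  proof -
    have "prob {\<omega>\<in>space M. real n * b / 2 \<le> \<bar>(\<Sum>i=1..n. Y i \<omega>) - real n * m\<bar>}
        \<le> (real n * V) / (real n * b / 2)\<^sup>2"
      unfolding EY[symmetric]
      by (rule Chebyshev_sum_indep[OF _ ind]) (use int[of _ 0 2] n0 V that in auto)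
    also have "\<dots> = 4 * V / (real n * b\<^sup>2)"
      using n0 that by (simp add: field_simps power2_eq_square)
    finally show ?thesis .
  qed
  have 2: "prob A2 \<le> 4 / real n"
    using cheb[of "sqrt V"] V unfolding A2_def by (simp add: field_simps)
  have 3: "prob A3 \<le> 4 * V / (real n * m\<^sup>2)"
    using cheb[of "\<bar>m\<bar>"] m unfolding A3_def by simp
  have "space M - D \<subseteq> A1 \<union> A2 \<union> A3"
  proof
    fix \<omega> assume \<omega>: "\<omega> \<in> space M - D"
    show "\<omega> \<in> A1 \<union> A2 \<union> A3"
    proof (rule ccontr)
      assume "\<omega> \<notin> A1 \<union> A2 \<union> A3"
      then show False
        using t_stat_square_ge[OF n V(2), of Y \<omega> m] \<omega> unfolding A1_def A2_def A3_def D_def by auto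
    qed
  qed
  then have "prob (space M - D) \<le> prob (A1 \<union> A2 \<union> A3)"
    by (intro finite_measure_mono) auto
  also have "\<dots> \<le> prob A1 + prob A2 + prob A3"
    using measure_Un_le[of "A1 \<union> A2" M A3] measure_Un_le[of A1 M A2] by simp
  also have "\<dots> \<le> 4 * W / (real n * V\<^sup>2) + 4 / real n + 4 * V / (real n * m\<^sup>2)"
    using 1 2 3 by linarith
  finally show ?thesis using prob_compl[of D] unfolding D_def[symmetric] by simp
qed

text \<open>Without recentring, the sum of squares exceeds \<open>n * sigma_hat\<close> by the
  squared sum over \<open>n\<close>, and normalisation turns this excess into the squared statistic
  over \<open>n\<close>. The left-hand side is the conditional variance of the bootstrap
  statistic.\<close>

lemma sum_square_weights:
  assumes "n \<ge> 1" "sigma_hat n Y \<omega> > 0"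
  shows "(\<Sum>i=1..n. (Y i \<omega> / sqrt (real n * sigma_hat n Y \<omega>))\<^sup>2) = 1 + (t_stat n Y \<omega>)\<^sup>2 / real n"
proof -
  define h where "h = sigma_hat n Y \<omega>"
  have h: "real n * h > 0" "n > 0" "h > 0" using assms h_def by simp_all
  have "h = (\<Sum>i=1..n. (Y i \<omega>)\<^sup>2) / real n - ((\<Sum>i=1..n. Y i \<omega>) / real n)\<^sup>2"
    using sigma_hat_eq[OF assms(1), of Y \<omega> 0] by (simp add: h_def)
  then have eq: "(\<Sum>i=1..n. (Y i \<omega>)\<^sup>2) = real n * h + (\<Sum>i=1..n. Y i \<omega>)\<^sup>2 / real n"
    using assms(1) by (simp add: field_simps power2_eq_square)
  have "(\<Sum>i=1..n. (Y i \<omega> / sqrt (real n * h))\<^sup>2) = (\<Sum>i=1..n. (Y i \<omega>)\<^sup>2) / (real n * h)"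
    using h by (simp add: power_divide sum_divide_distrib)
  also have "\<dots> = 1 + ((\<Sum>i=1..n. Y i \<omega>) / sqrt (real n * h))\<^sup>2 / real n"
    unfolding eq using h by (simp add: power_divide add_divide_distrib)
  finally show ?thesis unfolding t_stat_def h_def .
qed

subsection \<open>Gaussian tails and conditional quantiles\<close>

context prob_space
begin

lemma std_normal_mgf:
  assumes D: "distributed M lborel \<xi> std_normal_density"
  shows "(\<integral>\<^sup>+\<omega>. ennreal (exp (a * \<xi> \<omega>)) \<partial>M) = ennreal (exp (a\<^sup>2 / 2))"
proof -
  have "(\<integral>\<^sup>+\<omega>. ennreal (exp (a * \<xi> \<omega>)) \<partial>M)
      = (\<integral>\<^sup>+x. ennreal (std_normal_density x) * ennreal (exp (a * x)) \<partial>lborel)"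
    by (rule distributed_nn_integral[OF D, symmetric]) simp
  also have "\<dots> = (\<integral>\<^sup>+x. ennreal (exp (a\<^sup>2 / 2)) * ennreal (normal_density a 1 x) \<partial>lborel)"
  proof (rule nn_integral_cong)
    fix x :: real
    have "exp (- x\<^sup>2 / 2) * exp (a * x) = exp (a\<^sup>2 / 2) * exp (- (x - a)\<^sup>2 / 2)"
      unfolding exp_add[symmetric]
      by (rule arg_cong[where f = exp]) (simp add: power2_eq_square field_simps)
    then have "std_normal_density x * exp (a * x) = exp (a\<^sup>2 / 2) * normal_density a 1 x"
      by (simp add: normal_density_def)
    then show "ennreal (std_normal_density x) * ennreal (exp (a * x))
        = ennreal (exp (a\<^sup>2 / 2)) * ennreal (normal_density a 1 x)"
      by (simp add: ennreal_mult'[symmetric] ennreal_mult''[symmetric])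
  qed
  also have "\<dots> = ennreal (exp (a\<^sup>2 / 2)) * (\<integral>\<^sup>+x. ennreal (normal_density a 1 x) \<partial>lborel)"
    by (rule nn_integral_cmult) simp
  also have "(\<integral>\<^sup>+x. ennreal (normal_density a 1 x) \<partial>lborel) = 1"
    using prob_space.emeasure_space_1[OF prob_space_normal_density[of 1 a]]
    by (simp add: emeasure_density)
  finally show ?thesis by simp
qed

text \<open>Chernoff's bound; independence makes the moment generating function a product. Having
  only an upper bound \<open>v\<close> on the variance admits weights that all vanish, as for a
  degenerate studentization.\<close>

lemma gaussian_upper_tail:
  assumes I: "finite I" and ind: "indep_vars (\<lambda>_. borel) \<xi> I"
    and N: "\<And>i. i \<in> I \<Longrightarrow> distributed M lborel (\<xi> i) std_normal_density"
    and v: "(\<Sum>i\<in>I. (w i)\<^sup>2) \<le> v" "0 < v" and t: "0 \<le> t"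
  shows "prob {\<omega>\<in>space M. t \<le> (\<Sum>i\<in>I. w i * \<xi> i \<omega>)} \<le> exp (- t\<^sup>2 / (2 * v))"
proof -
  have rv[measurable]: "\<xi> i \<in> borel_measurable M" if "i \<in> I" for i
    using that ind by (auto simp: indep_vars_def)
  \<comment> \<open>The minimiser of the exponent \<open>- r * t + r^2 * v / 2\<close>.\<close>
  define r where "r = t / v"
  let ?u = "\<lambda>\<omega>. ennreal (exp (r * (\<Sum>i\<in>I. w i * \<xi> i \<omega>)))"
  have u[measurable]: "?u \<in> borel_measurable M" by measurable
  have "(\<integral>\<^sup>+\<omega>. ?u \<omega> \<partial>M) = (\<integral>\<^sup>+\<omega>. (\<Prod>i\<in>I. ennreal (exp ((r * w i) * \<xi> i \<omega>))) \<partial>M)"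
    by (simp add: sum_distrib_left exp_sum I prod_ennreal ac_simps)
  also have "\<dots> = (\<Prod>i\<in>I. \<integral>\<^sup>+\<omega>. ennreal (exp ((r * w i) * \<xi> i \<omega>)) \<partial>M)"
  proof (rule indep_vars_nn_integral[OF I])
    show "indep_vars (\<lambda>_. borel) (\<lambda>i \<omega>. ennreal (exp ((r * w i) * \<xi> i \<omega>))) I"
      using indep_vars_compose2[OF ind, of "\<lambda>i z. ennreal (exp ((r * w i) * z))" "\<lambda>_. borel"] by simp
  qed simp
  also have "\<dots> = (\<Prod>i\<in>I. ennreal (exp ((r * w i)\<^sup>2 / 2)))"
    by (intro prod.cong refl std_normal_mgf N)
  also have "\<dots> = ennreal (exp (r\<^sup>2 * (\<Sum>i\<in>I. (w i)\<^sup>2) / 2))"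
    by (simp add: prod_ennreal exp_sum[symmetric] I sum_distrib_left sum_divide_distrib power_mult_distrib)
  also have "\<dots> \<le> ennreal (exp (r\<^sup>2 * v / 2))"
    using v by (intro ennreal_leI) (simp add: mult_left_mono)
  finally have E: "(\<integral>\<^sup>+\<omega>. ?u \<omega> \<partial>M) \<le> ennreal (exp (r\<^sup>2 * v / 2))" .
  have "emeasure M {\<omega>\<in>space M. t \<le> (\<Sum>i\<in>I. w i * \<xi> i \<omega>)}
      \<le> emeasure M {\<omega>\<in>space M. 1 \<le> ennreal (exp (- r * t)) * ?u \<omega>}"
  proof (rule emeasure_mono)
    show "{\<omega>\<in>space M. t \<le> (\<Sum>i\<in>I. w i * \<xi> i \<omega>)} \<subseteq> {\<omega>\<in>space M. 1 \<le> ennreal (exp (- r * t)) * ?u \<omega>}"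
    proof safe
      fix \<omega> assume "t \<le> (\<Sum>i\<in>I. w i * \<xi> i \<omega>)"
      then have "r * t \<le> r * (\<Sum>i\<in>I. w i * \<xi> i \<omega>)"
        using t v by (intro mult_left_mono) (auto simp: r_def)
      then have "1 \<le> exp (- r * t + r * (\<Sum>i\<in>I. w i * \<xi> i \<omega>))" by simp
      then have "1 \<le> exp (- r * t) * exp (r * (\<Sum>i\<in>I. w i * \<xi> i \<omega>))" by (simp only: exp_add)
      then show "1 \<le> ennreal (exp (- r * t)) * ?u \<omega>"
        by (simp add: ennreal_mult''[symmetric] del: mult_minus_left)
    qed
  qed measurable
  also have "\<dots> \<le> ennreal (exp (- r * t)) * (\<integral>\<^sup>+\<omega>. ?u \<omega> * indicator (space M) \<omega> \<partial>M)"
    by (rule nn_integral_Markov_inequality) measurable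
  also have "(\<integral>\<^sup>+\<omega>. ?u \<omega> * indicator (space M) \<omega> \<partial>M) = (\<integral>\<^sup>+\<omega>. ?u \<omega> \<partial>M)"
    by (rule nn_integral_cong) simp
  also have "ennreal (exp (- r * t)) * (\<integral>\<^sup>+\<omega>. ?u \<omega> \<partial>M) \<le> ennreal (exp (- r * t)) * ennreal (exp (r\<^sup>2 * v / 2))"
    by (rule mult_left_mono[OF E]) simp
  also have "\<dots> = ennreal (exp (- r * t + r\<^sup>2 * v / 2))"
    by (simp add: ennreal_mult''[symmetric] exp_add[symmetric])
  also have "- r * t + r\<^sup>2 * v / 2 = - t\<^sup>2 / (2 * v)"
    using v by (simp add: r_def field_simps power2_eq_square)
  finally show ?thesis by (simp add: emeasure_eq_measure)
qed

lemma gaussian_tail: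
  assumes I: "finite I" and ind: "indep_vars (\<lambda>_. borel) \<xi> I"
    and N: "\<And>i. i \<in> I \<Longrightarrow> distributed M lborel (\<xi> i) std_normal_density"
    and v: "(\<Sum>i\<in>I. (w i)\<^sup>2) \<le> v" "0 < v" and t: "0 \<le> t"
  shows "prob {\<omega>\<in>space M. t < \<bar>\<Sum>i\<in>I. w i * \<xi> i \<omega>\<bar>} \<le> 2 * exp (- t\<^sup>2 / (2 * v))"
proof -
  have rv[measurable]: "\<xi> i \<in> borel_measurable M" if "i \<in> I" for i
    using that ind by (auto simp: indep_vars_def)
  let ?A = "{\<omega>\<in>space M. t \<le> (\<Sum>i\<in>I. w i * \<xi> i \<omega>)}"
  let ?B = "{\<omega>\<in>space M. t \<le> (\<Sum>i\<in>I. - w i * \<xi> i \<omega>)}"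
  have "prob {\<omega>\<in>space M. t < \<bar>\<Sum>i\<in>I. w i * \<xi> i \<omega>\<bar>} \<le> prob (?A \<union> ?B)"
    by (rule finite_measure_mono) (auto simp: sum_negf)
  also have "\<dots> \<le> prob ?A + prob ?B"
    by (rule measure_Un_le) measurable
  also have "\<dots> \<le> exp (- t\<^sup>2 / (2 * v)) + exp (- t\<^sup>2 / (2 * v))"
    using v by (intro add_mono gaussian_upper_tail[OF I ind N _ v(2) t]) auto
  finally show ?thesis by simp
qed

text \<open>
  Disintegration over \<open>F\<close>: pairing the identity into \<open>F\<close> with the family \<open>\<xi>\<close> gives a product law,
  so bounds that hold for frozen data integrate over any event of \<open>F\<close>.
\<close>

lemma prob_frozen_le:
  assumes sub: "subalgebra M F"
    and rv: "\<And>i. i \<in> I \<Longrightarrow> \<xi> i \<in> borel_measurable M"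
    and ind: "indep_set (sets (gen_sigma M I \<xi>)) (sets F)"
    and A: "A \<in> sets F"
    and H: "H \<in> sets (F \<Otimes>\<^sub>M Pi\<^sub>M I (\<lambda>_. borel))"
    and bound: "\<And>x. x \<in> A \<Longrightarrow> prob {\<omega>\<in>space M. (x, \<lambda>i\<in>I. \<xi> i \<omega>) \<in> H} \<le> \<delta>"
  shows "prob {\<omega>\<in>A. (\<omega>, \<lambda>i\<in>I. \<xi> i \<omega>) \<in> H} \<le> \<delta> * prob A"
proof -
  let ?P = "Pi\<^sub>M I (\<lambda>_. borel) :: ('b \<Rightarrow> real) measure"
  let ?v = "\<lambda>\<omega>. \<lambda>i\<in>I. \<xi> i \<omega>"
  note [measurable] = rv A H
  have spF: "space F = space M" using sub by (simp add: subalgebra_def)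
  have AM[measurable]: "A \<in> sets M" using sub A by (auto simp: subalgebra_def)
  have AF: "A \<subseteq> space M" using sets.sets_into_space[OF A] spF by simp
  have v[measurable]: "?v \<in> measurable M ?P" by measurable
  have vG: "?v \<in> measurable (gen_sigma M I \<xi>) ?P"
    by (intro measurable_restrict measurable_gen_sigma)
  \<comment> \<open>The identity with the coarser \<open>F\<close> as target stands for the data:
    its law is the restriction of the probability to \<open>F\<close>, so no data vector has to be
    built.\<close>
  have id[measurable]: "(\<lambda>x. x) \<in> measurable M F"
    using sub by (auto simp: measurable_def subalgebra_def Int_absorb2 sets.sets_into_space)
  have pair: "(\<lambda>x. (x, ?v x)) \<in> measurable M (F \<Otimes>\<^sub>M ?P)" by measurable
  interpret N: prob_space "distr M F (\<lambda>x. x)" by (rule prob_space_distr[OF id])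
  interpret Q: prob_space "distr M ?P ?v" by (rule prob_space_distr[OF v])
  have eq: "distr M F (\<lambda>x. x) \<Otimes>\<^sub>M distr M ?P ?v = distr M (F \<Otimes>\<^sub>M ?P) (\<lambda>x. (x, ?v x))"
  proof (rule pair_measure_eqI)
    \<comment> \<open>On rectangles the product formula is exactly the independence of an event of
      the multipliers and an event of \<open>F\<close>.\<close>
    fix C D assume "C \<in> sets (distr M F (\<lambda>x. x))" "D \<in> sets (distr M ?P ?v)"
    then have C: "C \<in> sets F" and D: "D \<in> sets ?P" by auto
    have CM: "C \<subseteq> space M" using sets.sets_into_space[OF C] spF by simp
    have CD: "C \<times> D \<in> sets (F \<Otimes>\<^sub>M ?P)" using C D by simp
    have "?v -` D \<inter> space M \<in> sets (gen_sigma M I \<xi>)"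
      using measurable_sets[OF vG D] by simp
    then have "prob ((?v -` D \<inter> space M) \<inter> C) = prob (?v -` D \<inter> space M) * prob C"
      using indep_setD[OF ind _ C] by blast
    moreover have "(\<lambda>x. x) -` C \<inter> space M = C"
      "(\<lambda>x. (x, ?v x)) -` (C \<times> D) \<inter> space M = (?v -` D \<inter> space M) \<inter> C"
      using CM by auto
    ultimately show "emeasure (distr M F (\<lambda>x. x)) C * emeasure (distr M ?P ?v) D
        = emeasure (distr M (F \<Otimes>\<^sub>M ?P) (\<lambda>x. (x, ?v x))) (C \<times> D)"
      by (simp only: emeasure_distr[OF id C] emeasure_distr[OF v D] emeasure_distr[OF pair CD]
          emeasure_eq_measure ennreal_mult''[OF measure_nonneg, symmetric] mult.commute)
  qed (unfold_locales, simp cong: sets_pair_measure_cong)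
  define H' where "H' = H \<inter> (A \<times> space ?P)"
  have H'[measurable]: "H' \<in> sets (F \<Otimes>\<^sub>M ?P)" unfolding H'_def by measurable
  have vsp: "?v \<omega> \<in> space ?P" if "\<omega> \<in> space M" for \<omega> using measurable_space[OF v that] .
  have "emeasure M {\<omega>\<in>A. (\<omega>, ?v \<omega>) \<in> H} = emeasure (distr M (F \<Otimes>\<^sub>M ?P) (\<lambda>x. (x, ?v x))) H'"
    using AF vsp by (subst emeasure_distr[OF pair H']) (auto intro!: arg_cong[where f = "emeasure M"] simp: H'_def)
  also have "\<dots> = emeasure (distr M F (\<lambda>x. x) \<Otimes>\<^sub>M distr M ?P ?v) H'"
    unfolding eq ..
  also have "\<dots> = (\<integral>\<^sup>+x. emeasure (distr M ?P ?v) (Pair x -` H') \<partial>distr M F (\<lambda>x. x))"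
    by (rule Q.emeasure_pair_measure_alt) (simp add: H' cong: sets_pair_measure_cong)
  also have "\<dots> \<le> (\<integral>\<^sup>+x. ennreal \<delta> * indicator A x \<partial>distr M F (\<lambda>x. x))"
  proof (rule nn_integral_mono)
    fix x
    show "emeasure (distr M ?P ?v) (Pair x -` H') \<le> ennreal \<delta> * indicator A x"
    proof (cases "x \<in> A")
      case True
      have "emeasure (distr M ?P ?v) (Pair x -` H') = emeasure M (?v -` (Pair x -` H') \<inter> space M)"
        by (rule emeasure_distr) (use sets_Pair1[OF H'] in auto)
      also have "?v -` (Pair x -` H') \<inter> space M = {\<omega>\<in>space M. (x, ?v \<omega>) \<in> H}"
        using True vsp by (auto simp: H'_def)
      also have "emeasure M \<dots> \<le> ennreal \<delta>"
        unfolding emeasure_eq_measure by (rule ennreal_leI[OF bound[OF True]])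
      finally have f: "emeasure (distr M ?P ?v) (Pair x -` H') \<le> ennreal \<delta>" .
      have "indicator A x = (1 :: ennreal)" using True by simp
      then show ?thesis using f by (simp only: mult_1_right)
    qed (simp add: H'_def)
  qed
  also have "\<dots> = ennreal \<delta> * emeasure (distr M F (\<lambda>x. x)) A"
    by (rule nn_integral_cmult_indicator) (simp add: A)
  also have "emeasure (distr M F (\<lambda>x. x)) A = emeasure M A"
    using AF by (subst emeasure_distr[OF id A]) (auto intro!: arg_cong[where f = "emeasure M"])
  finally have le: "ennreal (prob {\<omega>\<in>A. (\<omega>, ?v \<omega>) \<in> H}) \<le> ennreal \<delta> * ennreal (prob A)"
    by (simp only: emeasure_eq_measure)
  show ?thesis
  proof (cases "A = {}")
    case False
    \<comment> \<open>A point of \<open>A\<close> exhibits \<open>\<delta>\<close> as an upper bound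
      of a probability; for empty \<open>A\<close> its sign is unknown.\<close>
    then have "0 \<le> \<delta>" using bound measure_nonneg order_trans by blast
    then show ?thesis
      using le ennreal_le_iff[of "\<delta> * prob A"] by (simp only: ennreal_mult measure_nonneg mult_nonneg_nonneg)
  qed simp
qed

end

text \<open>Right-continuity of the distribution function means that the infimum is attained, and
  \<open>0 < \<beta> < 1\<close> makes the set nonempty and bounded below. The equivalence trades
  the infimum for evaluations of the measure on half-lines.\<close>

lemma quantile_le_iff:
  assumes "prob_space N" "sets N = sets borel" "0 < \<beta>" "\<beta> < 1"
  shows "quantile N \<beta> \<le> t \<longleftrightarrow> \<beta> \<le> measure N {..t}"
proof -
  interpret prob_space N by fact
  interpret cdf_distribution N by unfold_locales (rule assms)
  show ?thesis
    using pseudoinverse[OF assms(3,4), of t] by (simp add: quantile_def cdf_def)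
qed

text \<open>Sublevel sets of the quantile are superlevel sets of the kernel evaluated on a
  half-line, and such evaluations are measurable.\<close>

lemma borel_measurable_quantile:
  assumes K: "K \<in> measurable F (prob_algebra borel)" and b: "0 < \<beta>" "\<beta> < 1"
  shows "(\<lambda>\<omega>. quantile (K \<omega>) \<beta>) \<in> borel_measurable F"
  unfolding borel_measurable_iff_le
proof
  fix t
  have "{\<omega>\<in>space F. quantile (K \<omega>) \<beta> \<le> t} = {\<omega>\<in>space F. \<beta> \<le> measure (K \<omega>) {..t}}"
    using measurable_space[OF K] quantile_le_iff[OF _ _ b] by (auto simp: space_prob_algebra)
  also have "\<dots> \<in> sets F"
  proof -
    have [measurable]: "(\<lambda>\<omega>. measure (K \<omega>) {..t}) \<in> borel_measurable F"
      by (rule measurable_compose[OF K measurable_measure_prob_algebra]) simp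
    show ?thesis by measurable
  qed
  finally show "{\<omega>\<in>space F. quantile (K \<omega>) \<beta> \<le> t} \<in> sets F" .
qed

text \<open>
  The kernel is only determined up to a null set for each fixed Borel set, so a random bound \<open>c\<close> is
  approached through rational thresholds.
\<close>

lemma (in prob_space) cond_quantile_le:
  assumes sub: "subalgebra M F" and W[measurable]: "W \<in> borel_measurable M"
    and K: "is_cond_distr M F W K" and c: "c \<in> borel_measurable F"
    and b: "0 < \<beta>" "\<beta> < 1"
    and le: "\<And>t A. A \<in> sets F \<Longrightarrow> (\<And>\<omega>. \<omega> \<in> A \<Longrightarrow> c \<omega> \<le> t) \<Longrightarrow> \<beta> * prob A \<le> prob {\<omega>\<in>A. W \<omega> \<le> t}"
  shows "AE \<omega> in M. quantile (K \<omega>) \<beta> \<le> c \<omega>"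
proof -
  have spF: "space F = space M" using sub by (simp add: subalgebra_def)
  interpret finite_measure_subalgebra M F by unfold_locales (rule sub)
  have 1: "AE \<omega> in M. c \<omega> \<le> t \<longrightarrow> \<beta> \<le> measure (K \<omega>) {..t}" for t
  proof -
    let ?f = "\<lambda>\<omega>. indicator {..t} (W \<omega>) :: real"
    let ?e = "real_cond_exp M F ?f"
    have f: "integrable M ?f" by (rule integrable_const_bound[where B = 1]) auto
    \<comment> \<open>The event of \<open>F\<close> on which the claim fails for \<open>t\<close>.
      By hypothesis the integral of \<open>\<beta> - ?e\<close> over it is at most 0, while the
      integrand is positive there; hence it is a null event.\<close>
    define A where "A = {\<omega>\<in>space F. c \<omega> \<le> t \<and> ?e \<omega> < \<beta>}"
    have A[measurable]: "A \<in> sets F" unfolding A_def using c by measurable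
    have AM[measurable]: "A \<in> sets M" using sub A by (auto simp: subalgebra_def)
    have int: "integrable M ?e" by (rule real_cond_exp_int(1)[OF f])
    have intA: "integrable M (\<lambda>\<omega>. indicator A \<omega> * (\<beta> - ?e \<omega>))"
      using integrable_mult_indicator[OF AM, of "\<lambda>\<omega>. \<beta> - ?e \<omega>"] int by simp
    have "(\<integral>\<omega>. indicator A \<omega> * ?e \<omega> \<partial>M) = (\<integral>\<omega>. indicator A \<omega> * ?f \<omega> \<partial>M)"
      using real_cond_exp_intA[OF f A] by (simp add: set_lebesgue_integral_def)
    also have "\<dots> = (\<integral>\<omega>. indicator {\<omega>\<in>A. W \<omega> \<le> t} \<omega> \<partial>M)"
      by (intro Bochner_Integration.integral_cong) (auto simp: indicator_def)
    also have "\<dots> = prob {\<omega>\<in>A. W \<omega> \<le> t}"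
    proof -
      have "{\<omega>\<in>A. W \<omega> \<le> t} = A \<inter> {\<omega>\<in>space M. W \<omega> \<le> t}"
        using sets.sets_into_space[OF AM] by auto
      then have "{\<omega>\<in>A. W \<omega> \<le> t} \<in> sets M" by simp
      then show ?thesis using sets.sets_into_space[OF AM] by (simp add: Int_absorb1 Int_absorb2 subset_iff)
    qed
    finally have eqA: "(\<integral>\<omega>. indicator A \<omega> * ?e \<omega> \<partial>M) = prob {\<omega>\<in>A. W \<omega> \<le> t}" .
    have "(\<integral>\<omega>. indicator A \<omega> * (\<beta> - ?e \<omega>) \<partial>M)
        = (\<integral>\<omega>. \<beta> * indicator A \<omega> - indicator A \<omega> * ?e \<omega> \<partial>M)"
      by (intro Bochner_Integration.integral_cong) (auto simp: algebra_simps)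
    also have "\<dots> = \<beta> * prob A - prob {\<omega>\<in>A. W \<omega> \<le> t}"
    proof (subst Bochner_Integration.integral_diff)
      show "integrable M (\<lambda>\<omega>. \<beta> * indicator A \<omega>)" by (intro integrable_mult_right integrable_real_indicator AM) (simp add: less_top[symmetric])
      show "integrable M (\<lambda>\<omega>. indicator A \<omega> * ?e \<omega>)" using integrable_mult_indicator[OF AM int] by simp
    qed (use eqA sets.sets_into_space[OF AM] in \<open>simp add: Int_absorb1 Int_absorb2\<close>)
    also have "\<dots> \<le> 0" using le[OF A, of t] by (simp add: A_def)
    finally have "(\<integral>\<omega>. indicator A \<omega> * (\<beta> - ?e \<omega>) \<partial>M) \<le> 0" .
    moreover have nn: "0 \<le> indicator A \<omega> * (\<beta> - ?e \<omega>)" for \<omega>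
      by (auto simp: indicator_def A_def)
    ultimately have "(\<integral>\<omega>. indicator A \<omega> * (\<beta> - ?e \<omega>) \<partial>M) = 0"
      by (intro antisym integral_nonneg_AE) auto
    then have "AE \<omega> in M. indicator A \<omega> * (\<beta> - ?e \<omega>) = 0"
      using integral_nonneg_eq_0_iff_AE[OF intA] nn by auto
    moreover have "AE \<omega> in M. measure (K \<omega>) {..t} = ?e \<omega>"
      using K unfolding is_cond_distr_def by auto
    ultimately show ?thesis
      using AE_space
    proof eventually_elim
      case (elim \<omega>)
      then show ?case by (auto simp: A_def indicator_def spF split: if_splits)
    qed
  qed
  then have "AE \<omega> in M. \<forall>r::rat. c \<omega> \<le> of_rat r \<longrightarrow> \<beta> \<le> measure (K \<omega>) {..of_rat r}"
    by (simp add: AE_all_countable)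
  then show ?thesis
    using AE_space
  proof eventually_elim
    case (elim \<omega>)
    have "K \<omega> \<in> space (prob_algebra borel)"
      using K elim(2) measurable_space unfolding is_cond_distr_def spF[symmetric] by metis
    then have N: "prob_space (K \<omega>)" "sets (K \<omega>) = sets borel" by (auto simp: space_prob_algebra)
    show ?case
    proof (rule ccontr)
      assume "\<not> quantile (K \<omega>) \<beta> \<le> c \<omega>"
      \<comment> \<open>A rational strictly between the two lies above \<open>c\<close> and below
        the quantile, against one of the countably many inequalities that hold almost
        surely.\<close>
      then obtain r where r: "c \<omega> < of_rat r" "of_rat r < quantile (K \<omega>) \<beta>"
        using of_rat_dense[of "c \<omega>" "quantile (K \<omega>) \<beta>"] by auto
      then show False using elim(1) quantile_le_iff[OF N b, of "of_rat r"] by force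
    qed
  qed
qed

subsection \<open>The bootstrap critical value\<close>

text \<open>Multipliers and data point are read off \<open>z\<close> by separate maps. One instance
  gives measurability on the original space, another on the product space, where the data can be
  frozen while the multipliers vary.\<close>

lemma borel_measurable_max_boot:
  assumes [measurable]: "\<And>i. i \<in> {1..n} \<Longrightarrow> (\<lambda>z. e z i) \<in> borel_measurable N"
    and [measurable]: "f \<in> measurable N F"
    and X: "\<And>i j. i \<in> {1..n} \<Longrightarrow> j \<in> {1..p} \<Longrightarrow> X i j \<in> borel_measurable F"
    and S: "\<And>l. l \<in> {1..d} \<Longrightarrow> S l \<subseteq> {1..p}"
  shows "(\<lambda>z. max_boot n d (\<lambda>i _. e z i) X S (f z)) \<in> borel_measurable N"
  unfolding max_boot_def
proof (rule borel_measurable_Max)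
  fix l assume l: "l \<in> {1..d}"
  have Y[measurable]: "block_sum X (S l) i \<in> borel_measurable F" if "i \<in> {1..n}" for i
    unfolding block_sum_def by (rule borel_measurable_sum) (use X S[OF l] that in auto)
  have [measurable]: "sigma_hat n (block_sum X (S l)) \<in> borel_measurable F"
    by (rule borel_measurable_sigma_hat) (rule Y)
  show "(\<lambda>z. \<bar>t_boot n (\<lambda>i _. e z i) (block_sum X (S l)) (f z)\<bar>) \<in> borel_measurable N"
    unfolding t_boot_def by measurable
qed simp

lemma borel_measurable_max_stat:
  assumes X: "\<And>i j. i \<in> {1..n} \<Longrightarrow> j \<in> {1..p} \<Longrightarrow> X i j \<in> borel_measurable F"
    and S: "\<And>l. l \<in> {1..d} \<Longrightarrow> S l \<subseteq> {1..p}"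
  shows "max_stat n d X S \<in> borel_measurable F"
  unfolding max_stat_def
proof (rule borel_measurable_Max)
  fix l assume l: "l \<in> {1..d}"
  have Y: "block_sum X (S l) i \<in> borel_measurable F" if "i \<in> {1..n}" for i
    unfolding block_sum_def by (rule borel_measurable_sum) (use X S[OF l] that in auto)
  have [measurable]: "t_stat n (block_sum X (S l)) \<in> borel_measurable F"
    by (rule borel_measurable_t_stat) (rule Y)
  show "(\<lambda>z. \<bar>t_stat n (block_sum X (S l)) z\<bar>) \<in> borel_measurable F" by measurable
qed simp

lemma abs_t_stat_le_max_stat:
  "l \<in> {1..d} \<Longrightarrow> \<bar>t_stat n (block_sum X (S l)) \<omega>\<bar> \<le> max_stat n d X S \<omega>"
  unfolding max_stat_def by (intro Max_ge) auto

text \<open>A degenerate \<open>sigma_hat\<close> makes every weight zero by the convention on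
  division, so the bound persists where the exact formula fails.\<close>

lemma sum_square_weights_le:
  assumes "n \<ge> 1" "\<bar>t_stat n Y \<omega>\<bar> \<le> T"
  shows "(\<Sum>i=1..n. (Y i \<omega> / sqrt (real n * sigma_hat n Y \<omega>))\<^sup>2) \<le> 1 + T\<^sup>2 / real n"
proof (cases "sigma_hat n Y \<omega> > 0")
  case True
  have "(t_stat n Y \<omega>)\<^sup>2 \<le> T\<^sup>2" using power_mono[OF assms(2), of 2] by simp
  then show ?thesis
    unfolding sum_square_weights[OF assms(1) True] by (simp add: divide_right_mono)
next
  case False
  then have "sigma_hat n Y \<omega> = 0" using sigma_hat_nonneg[of n Y \<omega>] by linarith
  then show ?thesis by simp
qed

text \<open>
  Given the data, each bootstrap statistic is a centred Gaussian of variance at most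
  \<open>1 + M\<^sup>2 / n\<close>, since the bootstrap sums are not recentred.
\<close>

lemma (in prob_space) quantile_max_boot_le:
  fixes X :: "nat \<Rightarrow> nat \<Rightarrow> 'a \<Rightarrow> real" and \<xi> :: "nat \<Rightarrow> 'a \<Rightarrow> real"
  assumes n: "n \<ge> 1" and d: "d \<ge> 1" and alpha: "0 < \<alpha>" "\<alpha> < 1"
    and X: "\<And>i j. i \<in> {1..n} \<Longrightarrow> j \<in> {1..p} \<Longrightarrow> X i j \<in> borel_measurable M"
    and S: "\<And>l. l \<in> {1..d} \<Longrightarrow> S l \<subseteq> {1..p}"
    and xi: "indep_vars (\<lambda>_. borel) \<xi> {1..n}"
    and N: "\<And>i. i \<in> {1..n} \<Longrightarrow> distributed M lborel (\<xi> i) std_normal_density"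
    and ind: "indep_set (sets (gen_sigma M {1..n} \<xi>)) (sets (data_sigma M n p X))"
    and K: "is_cond_distr M (data_sigma M n p X) (max_boot n d \<xi> X S) K"
  shows "AE \<omega> in M. quantile (K \<omega>) (1 - \<alpha>)
    \<le> sqrt (2 * ln (2 * real d / \<alpha>)) * sqrt (1 + (max_stat n d X S \<omega>)\<^sup>2 / real n)"
proof -
  let ?F = "data_sigma M n p X" and ?P = "Pi\<^sub>M {1..n} (\<lambda>_. borel) :: (nat \<Rightarrow> real) measure"
  let ?v = "\<lambda>\<omega>. \<lambda>i\<in>{1..n}. \<xi> i \<omega>"
  \<comment> \<open>Chosen so that a union bound over \<open>d\<close> statistics, each with
    two-sided tail \<open>2 * exp (- L / 2)\<close>, gives exactly \<alpha>.\<close>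
  define L where "L = 2 * ln (2 * real d / \<alpha>)"
  have da: "2 * real d / \<alpha> > 1" using d alpha by (simp add: field_simps)
  have L: "L > 0" using da by (simp add: L_def)
  have expL: "2 * exp (- L / 2) = \<alpha> / real d"
    using da alpha d by (simp add: L_def exp_minus)
  define c where "c \<omega> = sqrt L * sqrt (1 + (max_stat n d X S \<omega>)\<^sup>2 / real n)" for \<omega>
  have sub: "subalgebra M ?F"
    unfolding data_sigma_def by (rule subalgebra_gen_sigma) (use X in auto)
  have spF: "space ?F = space M" using sub by (simp add: subalgebra_def)
  have XF: "X i j \<in> borel_measurable ?F" if "i \<in> {1..n}" "j \<in> {1..p}" for i j
    unfolding data_sigma_def
    using measurable_gen_sigma[of "(i, j)" "{1..n} \<times> {1..p}" "\<lambda>(i, j). X i j" M] that by simp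
  have [measurable]: "max_stat n d X S \<in> borel_measurable ?F"
    by (rule borel_measurable_max_stat[OF XF S])
  have cF: "c \<in> borel_measurable ?F" unfolding c_def by measurable
  have xirv: "\<xi> i \<in> borel_measurable M" if "i \<in> {1..n}" for i
    using that xi by (auto simp: indep_vars_def)
  have W: "max_boot n d \<xi> X S \<in> borel_measurable M"
  proof -
    have "max_boot n d \<xi> X S = (\<lambda>\<omega>. max_boot n d (\<lambda>i _. \<xi> i \<omega>) X S \<omega>)"
      by (rule ext) (simp add: max_boot_def t_boot_def)
    also have "\<dots> \<in> borel_measurable M"
      by (rule borel_measurable_max_boot[OF xirv measurable_ident_sets[OF refl] X S])
    finally show ?thesis .
  qed
  have "AE \<omega> in M. quantile (K \<omega>) (1 - \<alpha>) \<le> c \<omega>"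
  proof (rule cond_quantile_le[OF sub W K cF])
    fix t A assume A: "A \<in> sets ?F" and le: "\<And>\<omega>. \<omega> \<in> A \<Longrightarrow> c \<omega> \<le> t"
    have AM: "A \<in> sets M" using sub A by (auto simp: subalgebra_def)
    define B where "B z = max_boot n d (\<lambda>i _. snd z i) X S (fst z)" for z :: "'a \<times> (nat \<Rightarrow> real)"
    have [measurable]: "B \<in> borel_measurable (?F \<Otimes>\<^sub>M ?P)"
      unfolding B_def
      by (rule borel_measurable_max_boot[where F = ?F, OF _ measurable_fst XF S])
        (auto intro!: measurable_compose[OF measurable_snd measurable_component_singleton])
    define H where "H = {z \<in> space (?F \<Otimes>\<^sub>M ?P). t < B z}"
    have H: "H \<in> sets (?F \<Otimes>\<^sub>M ?P)" unfolding H_def by measurable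
    have BW: "B (\<omega>, ?v \<omega>') = max_boot n d (\<lambda>i _. \<xi> i \<omega>') X S \<omega>" for \<omega> \<omega>'
      unfolding B_def max_boot_def t_boot_def by simp
    have vsp: "?v \<omega> \<in> space ?P" for \<omega> by (simp add: space_PiM)
    have "prob {\<omega>\<in>A. (\<omega>, ?v \<omega>) \<in> H} \<le> \<alpha> * prob A"
    proof (rule prob_frozen_le[OF sub xirv ind A H])
      fix x assume x: "x \<in> A"
      have xM: "x \<in> space M" using x sets.sets_into_space[OF AM] by auto
      define v where "v = 1 + (max_stat n d X S x)\<^sup>2 / real n"
      have v: "v > 0" by (auto simp: v_def intro!: add_pos_nonneg)
      have ct: "sqrt (L * v) \<le> t" using le[OF x] by (simp add: c_def v_def real_sqrt_mult)
      have t0: "0 \<le> t" using ct L v by (meson order_trans real_sqrt_ge_zero mult_nonneg_nonneg less_imp_le)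
      have "(sqrt (L * v))\<^sup>2 \<le> t\<^sup>2" using ct L v by (intro power_mono) auto
      then have t2: "L * v \<le> t\<^sup>2" using L v by simp
      let ?w = "\<lambda>l i. block_sum X (S l) i x / sqrt (real n * sigma_hat n (block_sum X (S l)) x)"
      have tb: "t_boot n (\<lambda>i _. \<xi> i \<omega>) (block_sum X (S l)) x = (\<Sum>i=1..n. ?w l i * \<xi> i \<omega>)" for l \<omega>
        by (simp add: t_boot_def sum_divide_distrib mult.commute)
      have "{\<omega>\<in>space M. (x, ?v \<omega>) \<in> H}
          \<subseteq> (\<Union>l\<in>{1..d}. {\<omega>\<in>space M. t < \<bar>\<Sum>i=1..n. ?w l i * \<xi> i \<omega>\<bar>})"
      proof
        fix \<omega> assume "\<omega> \<in> {\<omega>\<in>space M. (x, ?v \<omega>) \<in> H}"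
        then have \<omega>: "\<omega> \<in> space M" and "t < B (x, ?v \<omega>)" by (auto simp: H_def)
        then have "t < (MAX l\<in>{1..d}. \<bar>\<Sum>i=1..n. ?w l i * \<xi> i \<omega>\<bar>)"
          unfolding BW max_boot_def tb by simp
        then show "\<omega> \<in> (\<Union>l\<in>{1..d}. {\<omega>\<in>space M. t < \<bar>\<Sum>i=1..n. ?w l i * \<xi> i \<omega>\<bar>})"
          using d \<omega> by (subst (asm) Max_gr_iff) auto
      qed
      then have "prob {\<omega>\<in>space M. (x, ?v \<omega>) \<in> H}
          \<le> prob (\<Union>l\<in>{1..d}. {\<omega>\<in>space M. t < \<bar>\<Sum>i=1..n. ?w l i * \<xi> i \<omega>\<bar>})"
        using xirv by (intro finite_measure_mono sets.finite_UN) measurable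
      also have "\<dots> \<le> (\<Sum>l\<in>{1..d}. prob {\<omega>\<in>space M. t < \<bar>\<Sum>i=1..n. ?w l i * \<xi> i \<omega>\<bar>})"
        using xirv by (intro finite_measure_subadditive_finite) (auto, measurable)
      also have "\<dots> \<le> (\<Sum>l\<in>{1..d}. \<alpha> / real d)"
      proof (rule sum_mono)
        fix l assume l: "l \<in> {1..d}"
        have "prob {\<omega>\<in>space M. t < \<bar>\<Sum>i=1..n. ?w l i * \<xi> i \<omega>\<bar>} \<le> 2 * exp (- t\<^sup>2 / (2 * v))"
          by (rule gaussian_tail[OF _ xi N _ v t0])
            (use sum_square_weights_le[OF n abs_t_stat_le_max_stat[OF l]] in \<open>auto simp: v_def\<close>)
        also have "\<dots> \<le> 2 * exp (- L / 2)"
          using t2 v by (simp add: field_simps)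
        finally show "prob {\<omega>\<in>space M. t < \<bar>\<Sum>i=1..n. ?w l i * \<xi> i \<omega>\<bar>} \<le> \<alpha> / real d"
          unfolding expL .
      qed
      also have "\<dots> = \<alpha>" using d by simp
      finally show "prob {\<omega>\<in>space M. (x, ?v \<omega>) \<in> H} \<le> \<alpha>" .
    qed
    also have "{\<omega>\<in>A. (\<omega>, ?v \<omega>) \<in> H} = A - {\<omega>\<in>A. max_boot n d \<xi> X S \<omega> \<le> t}"
    proof -
      have "B (\<omega>, ?v \<omega>) = max_boot n d \<xi> X S \<omega>" for \<omega>
        unfolding BW by (simp add: max_boot_def t_boot_def)
      then show ?thesis
        using sets.sets_into_space[OF A] vsp by (auto simp: H_def space_pair_measure)
    qed
    also have "prob \<dots> = prob A - prob {\<omega>\<in>A. max_boot n d \<xi> X S \<omega> \<le> t}"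
    proof (rule finite_measure_Diff[OF AM])
      have "{\<omega>\<in>A. max_boot n d \<xi> X S \<omega> \<le> t} = A \<inter> {\<omega>\<in>space M. max_boot n d \<xi> X S \<omega> \<le> t}"
        using sets.sets_into_space[OF AM] by auto
      also have "\<dots> \<in> sets M" using W AM by measurable
      finally show "{\<omega>\<in>A. max_boot n d \<xi> X S \<omega> \<le> t} \<in> sets M" .
    qed auto
    finally show "(1 - \<alpha>) * prob A \<le> prob {\<omega>\<in>A. max_boot n d \<xi> X S \<omega> \<le> t}"
      by (simp add: algebra_simps)
  qed (use alpha in auto)
  then show ?thesis by (simp add: c_def L_def)
qed

subsection \<open>Power for a fixed sample size\<close>

text \<open>Translations of the line are Borel measurable in both directions, so a shifted
  coordinate has the same preimages of Borel sets.\<close>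

lemma gen_sigma_shift:
  fixes Z :: "'i \<Rightarrow> 'a \<Rightarrow> real"
  shows "gen_sigma M I (\<lambda>j \<omega>. Z j \<omega> - b j) = gen_sigma M I Z"
proof -
  have "{(\<lambda>\<omega>. Z j \<omega> - b j) -` B \<inter> space M | B. B \<in> sets borel} = {Z j -` B \<inter> space M | B. B \<in> sets borel}"
    (is "?L = ?R") for j
  proof (intro equalityI subsetI)
    fix E assume "E \<in> ?L"
    then obtain B where B: "B \<in> sets borel" "E = (\<lambda>\<omega>. Z j \<omega> - b j) -` B \<inter> space M" by auto
    have "(\<lambda>x::real. x - b j) -` B \<in> sets borel"
      using measurable_sets[of "\<lambda>x::real. x - b j" borel borel B] B(1) by simp
    moreover have "E = Z j -` ((\<lambda>x. x - b j) -` B) \<inter> space M" using B(2) by auto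
    ultimately show "E \<in> ?R" by blast
  next
    fix E assume "E \<in> ?R"
    then obtain B where B: "B \<in> sets borel" "E = Z j -` B \<inter> space M" by auto
    have "(\<lambda>x::real. x + b j) -` B \<in> sets borel"
      using measurable_sets[of "\<lambda>x::real. x + b j" borel borel B] B(1) by simp
    moreover have "E = (\<lambda>\<omega>. Z j \<omega> - b j) -` ((\<lambda>x. x + b j) -` B) \<inter> space M" using B(2) by auto
    ultimately show "E \<in> ?L" by blast
  qed
  then show ?thesis unfolding gen_sigma_def by simp
qed

text \<open>The coefficient sees a row only through its sigma-fields. Thus the mixing rate passes to
  the centred row, for which the moment bounds are stated.\<close>

lemma rho_mixing_shift: "rho_mixing M p (\<lambda>j \<omega>. Z j \<omega> - b j) m = rho_mixing M p Z m"
  unfolding rho_mixing_def gen_sigma_shift ..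

lemma moment_le_max_moment:
  "i \<in> {1..n} \<Longrightarrow> j \<in> {1..p} \<Longrightarrow> (\<integral>\<omega>. (X i j \<omega> - \<mu> j) ^ r \<partial>M) \<le> max_moment M n p X \<mu> r"
  unfolding max_moment_def by (rule Max_ge) (auto intro: image_eqI[where x = "(i, j)"])

lemma min_moment_le_moment:
  "i \<in> {1..n} \<Longrightarrow> j \<in> {1..p} \<Longrightarrow> min_moment M n p X \<mu> r \<le> (\<integral>\<omega>. (X i j \<omega> - \<mu> j) ^ r \<partial>M)"
  unfolding min_moment_def by (rule Min_le) (auto intro: image_eqI[where x = "(i, j)"])

context prob_space
begin

text \<open>With \<open>L = 2 * ln (2 * d / \<alpha>)\<close> and \<open>T\<close> the maximum,
  \<open>2 * L <= n\<close> and \<open>2 * L < T^2\<close> give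
  \<open>L * (1 + T^2 / n) <= L + T^2 / 2 < T^2\<close>, which forces rejection up to a null set. In
  the error terms the average variance is replaced by \<open>c * q * s_min\<close> where it divides
  and by \<open>G * v\<close> where it multiplies.\<close>

lemma prob_max_stat_gt_quantile_ge:
  fixes X :: "nat \<Rightarrow> nat \<Rightarrow> 'a \<Rightarrow> real" and \<xi> :: "nat \<Rightarrow> 'a \<Rightarrow> real"
  assumes n: "n \<ge> 1" and d: "d \<ge> 1" and alpha: "0 < \<alpha>" "\<alpha> < 1"
    and indep: "indep_vars (\<lambda>_. Pi\<^sub>M {1..p} (\<lambda>_. borel)) (\<lambda>i \<omega>. \<lambda>j\<in>{1..p}. X i j \<omega>) {1..n}"
    and bounded: "\<And>i j. i \<in> {1..n} \<Longrightarrow> j \<in> {1..p} \<Longrightarrow> AE \<omega> in M. \<bar>X i j \<omega>\<bar> \<le> C"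
    and C: "C > 0"
    and mean: "\<And>i j. i \<in> {1..n} \<Longrightarrow> j \<in> {1..p} \<Longrightarrow> expectation (X i j) = \<mu> j"
    and S: "\<And>l. l \<in> {1..d} \<Longrightarrow> S l \<subseteq> {1..p} \<and> card (S l) = q"
    and xi: "indep_vars (\<lambda>_. borel) \<xi> {1..n}"
    and N: "\<And>i. i \<in> {1..n} \<Longrightarrow> distributed M lborel (\<xi> i) std_normal_density"
    and ind: "indep_set (sets (gen_sigma M {1..n} \<xi>)) (sets (data_sigma M n p X))"
    and K: "is_cond_distr M (data_sigma M n p X) (max_boot n d \<xi> X S) K"
    and tau: "0 \<le> \<tau>" "\<tau> < 1"
    and mix: "\<And>i m. i \<in> {1..n} \<Longrightarrow> 1 \<le> m \<Longrightarrow> m \<le> p - 1 \<Longrightarrow> rho_mixing M p (X i) m \<le> \<tau> ^ (12 * m)"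
    and c: "c > 0"
    and var: "\<And>i l. i \<in> {1..n} \<Longrightarrow> l \<in> {1..d} \<Longrightarrow>
      variance (block_sum X (S l) i) \<ge> c * (\<Sum>j\<in>S l. variance (X i j))"
    and q: "q \<ge> 1" and smin: "min_moment M n p X \<mu> 2 > 0"
    and l: "l \<in> {1..d}" and m: "(\<Sum>j\<in>S l. \<mu> j) \<noteq> 0"
    and v_def: "v = real q * max_moment M n p X \<mu> 2"
    and G_def: "G = 2 / (1 - \<tau>)"
    and L: "4 * ln (2 * real d / \<alpha>) \<le> real n"
    and power: "4 * ln (2 * real d / \<alpha>) < real n * (\<Sum>j\<in>S l. \<mu> j)\<^sup>2 / (6 * (G * v))"
  shows "prob {\<omega>\<in>space M. max_stat n d X S \<omega> > quantile (K \<omega>) (1 - \<alpha>)}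
    \<ge> 1 - (4 * ((2 * C)\<^sup>2 * G ^ 3 * v + 3 * G\<^sup>2 * v\<^sup>2) / (real n * (c * (real q * min_moment M n p X \<mu> 2))\<^sup>2)
        + 4 / real n + 4 * (G * v) / (real n * (\<Sum>j\<in>S l. \<mu> j)\<^sup>2))"
proof -
  define s where "s = max_moment M n p X \<mu> 2"
  define s' where "s' = min_moment M n p X \<mu> 2"
  define Y where "Y = block_sum X (S l)"
  define \<nu> where "\<nu> = (\<Sum>j\<in>S l. \<mu> j)"
  have Sl: "S l \<subseteq> {1..p}" "card (S l) = q" using S[OF l] by auto
  have finS: "finite (S l)" using Sl(1) finite_subset by blast
  obtain j0 where j0: "j0 \<in> S l" using Sl q by fastforce
  then have j0p: "j0 \<in> {1..p}" using Sl by auto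
  have vecs: "(\<lambda>\<omega>. \<lambda>j\<in>{1..p}. X i j \<omega>) \<in> measurable M (Pi\<^sub>M {1..p} (\<lambda>_. borel))" if "i \<in> {1..n}" for i
    using that indep by (auto simp: indep_vars_def)
  have rv: "X i j \<in> borel_measurable M" if "i \<in> {1..n}" "j \<in> {1..p}" for i j
    using measurable_compose[OF vecs[OF that(1)] measurable_component_singleton[OF that(2)]] that by simp
  have intX: "integrable M (X i j)" if "i \<in> {1..n}" "j \<in> {1..p}" for i j
    using bounded[OF that] rv[OF that] by (intro integrable_const_bound[where B = C]) auto
  \<comment> \<open>The means inherit the bound \<open>C\<close>, which is why centred coordinates
    are bounded by \<open>2 * C\<close>.\<close>
  have mu: "\<bar>\<mu> j\<bar> \<le> C" if j: "j \<in> {1..p}" for j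
  proof -
    have i: "1 \<in> {1..n}" using n by simp
    have "\<bar>\<mu> j\<bar> \<le> expectation (\<lambda>\<omega>. \<bar>X 1 j \<omega>\<bar>)"
      unfolding mean[OF i j, symmetric] by (rule integral_abs_bound)
    also have "\<dots> \<le> expectation (\<lambda>_. C)"
      using bounded[OF i j] intX[OF i j] by (intro integral_mono_AE) auto
    finally show ?thesis by (simp add: prob_space)
  qed
  have one: "1 \<in> {1..n}" using n by simp
  have s's: "s' \<le> s"
    using min_moment_le_moment[OF one j0p, where X = X and M = M and \<mu> = \<mu> and r = 2]
      moment_le_max_moment[OF one j0p, where X = X and M = M and \<mu> = \<mu> and r = 2]
    unfolding s_def s'_def by linarith
  have s'0: "s' > 0" using smin by (simp add: s'_def)
  have s0: "s > 0" using s's s'0 by simp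
  have v: "v = real q * s" "v > 0" using q s0 by (auto simp: v_def s_def)
  have G: "G > 0" using tau by (simp add: G_def)
  have row: "mixing_row M p (\<lambda>j \<omega>. X i j \<omega> - \<mu> j) (2 * C) s \<tau>" if i: "i \<in> {1..n}" for i
  proof unfold_locales
    fix j assume j: "j \<in> {1..p}"
    show "(\<lambda>\<omega>. X i j \<omega> - \<mu> j) \<in> borel_measurable M" using rv[OF i j] by measurable
    show "AE \<omega> in M. \<bar>X i j \<omega> - \<mu> j\<bar> \<le> 2 * C"
      using bounded[OF i j] by eventually_elim (use mu[OF j] in linarith)
    show "expectation (\<lambda>\<omega>. X i j \<omega> - \<mu> j) = 0"
      using intX[OF i j] mean[OF i j] by (simp add: prob_space)
    show "expectation (\<lambda>\<omega>. (X i j \<omega> - \<mu> j)\<^sup>2) \<le> s"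
      unfolding s_def by (rule moment_le_max_moment[OF i j])
  next
    fix k m :: nat assume "1 \<le> k" "1 \<le> m" "k + m \<le> p"
    then show "rho_mixing M p (\<lambda>j \<omega>. X i j \<omega> - \<mu> j) m \<le> \<tau> ^ (12 * m)"
      unfolding rho_mixing_shift by (intro mix[OF i]) auto
  qed (use C s0 tau in auto)
  have Ym: "Y i \<omega> - \<nu> = (\<Sum>j\<in>S l. X i j \<omega> - \<mu> j)" for i \<omega>
    by (simp add: Y_def block_sum_def \<nu>_def sum_subtractf)
  have EY: "expectation (Y i) = \<nu>" if i: "i \<in> {1..n}" for i
    unfolding Y_def block_sum_def \<nu>_def using Sl(1) intX[OF i] mean[OF i]
    by (subst Bochner_Integration.integral_sum) (auto intro!: sum.cong)
  have indY: "indep_vars (\<lambda>_. borel) Y {1..n}"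
  proof -
    \<comment> \<open>Independence holds between whole rows, and each block sum is a measurable
      function of its own row.\<close>
    have "indep_vars (\<lambda>_. borel) (\<lambda>i \<omega>. \<Sum>j\<in>S l. (\<lambda>j\<in>{1..p}. X i j \<omega>) j) {1..n}"
    proof (rule indep_vars_compose2[OF indep])
      show "(\<lambda>x. \<Sum>j\<in>S l. x j :: real) \<in> borel_measurable (Pi\<^sub>M {1..p} (\<lambda>_. borel))"
        by (rule borel_measurable_sum[where f = "\<lambda>j x. x j"], rule measurable_component_singleton)
          (use Sl(1) in blast)
    qed
    also have "(\<lambda>i \<omega>. \<Sum>j\<in>S l. (\<lambda>j\<in>{1..p}. X i j \<omega>) j) = Y"
      unfolding Y_def block_sum_def using Sl(1) by (auto intro!: ext sum.cong)
    finally show ?thesis .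
  qed
  have var_le: "variance (Y i) \<le> G * v" if i: "i \<in> {1..n}" for i
  proof -
    interpret R: mixing_row M p "\<lambda>j \<omega>. X i j \<omega> - \<mu> j" "2 * C" s \<tau> by (rule row[OF i])
    have "variance (Y i) = expectation (\<lambda>\<omega>. (\<Sum>j\<in>S l. X i j \<omega> - \<mu> j)\<^sup>2)"
      unfolding EY[OF i] Ym ..
    also have "\<dots> \<le> s * (real (card (S l)) * (2 / (1 - \<tau>)))"
      by (rule R.second_moment_sum_le[OF Sl(1)])
    finally show ?thesis by (simp add: v G_def Sl mult_ac)
  qed
  have var_ge: "c * (real q * s') \<le> variance (Y i)" if i: "i \<in> {1..n}" for i
  proof -
    have "real q * s' = (\<Sum>j\<in>S l. s')" using Sl by simp
    also have "\<dots> \<le> (\<Sum>j\<in>S l. variance (X i j))"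
    proof (rule sum_mono)
      fix j assume "j \<in> S l"
      then have j: "j \<in> {1..p}" using Sl by auto
      show "s' \<le> variance (X i j)"
        using min_moment_le_moment[OF i j, where X = X and M = M and \<mu> = \<mu> and r = 2] by (simp add: mean[OF i j] s'_def)
    qed
    finally show ?thesis
      using var[OF i l] c unfolding Y_def by (meson mult_left_mono order_trans less_imp_le)
  qed
  define V where "V = (\<Sum>i=1..n. variance (Y i)) / real n"
  have n0: "real n > 0" using n by simp
  have V_le: "V \<le> G * v"
    using sum_mono[of "{1..n}" "\<lambda>i. variance (Y i)" "\<lambda>_. G * v"] var_le n0
    by (simp add: V_def field_simps)
  have V_ge: "c * (real q * s') \<le> V"
    using sum_mono[of "{1..n}" "\<lambda>_. c * (real q * s')" "\<lambda>i. variance (Y i)"] var_ge n0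
    by (simp add: V_def field_simps)
  have cq: "c * (real q * s') > 0" using c q s'0 by simp
  have V0: "V > 0" using V_ge cq by linarith
  define W where "W = (2 * C)\<^sup>2 * G ^ 3 * v + 3 * G\<^sup>2 * v\<^sup>2"
  have W0: "W \<ge> 0" using G v by (simp add: W_def)
  have four: "expectation (\<lambda>\<omega>. (Y i \<omega> - \<nu>) ^ 4) \<le> W" if i: "i \<in> {1..n}" for i
  proof -
    interpret R: mixing_row M p "\<lambda>j \<omega>. X i j \<omega> - \<mu> j" "2 * C" s \<tau> by (rule row[OF i])
    show ?thesis
      unfolding Ym using R.fourth_moment_sum_le[OF Sl(1)]
      by (simp add: W_def v G_def[symmetric] Sl mult_ac power_mult_distrib)
  qed
  have bdd: "AE \<omega> in M. \<bar>Y i \<omega>\<bar> \<le> real q * C" if i: "i \<in> {1..n}" for i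
  proof -
    have "AE \<omega> in M. \<forall>j\<in>S l. \<bar>X i j \<omega>\<bar> \<le> C"
      using bounded[OF i] Sl(1) finS by (intro AE_finite_allI) auto
    then show ?thesis
    proof eventually_elim
      case (elim \<omega>)
      have "\<bar>Y i \<omega>\<bar> \<le> (\<Sum>j\<in>S l. \<bar>X i j \<omega>\<bar>)" unfolding Y_def block_sum_def by (rule sum_abs)
      also have "\<dots> \<le> (\<Sum>j\<in>S l. C)" using elim by (intro sum_mono) auto
      finally show ?case using Sl by simp
    qed
  qed
  define D where "D = {\<omega>\<in>space M. real n * \<nu>\<^sup>2 / (6 * V) \<le> (t_stat n Y \<omega>)\<^sup>2}"
  have D_ge: "prob D \<ge> 1 - (4 * W / (real n * V\<^sup>2) + 4 / real n + 4 * V / (real n * \<nu>\<^sup>2))"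
    unfolding D_def
    by (rule prob_t_stat_large[OF n indY bdd EY _ V0 four]) (use n0 m in \<open>auto simp: V_def \<nu>_def\<close>)
  have \<nu>2: "\<nu>\<^sup>2 > 0" using m by (simp add: \<nu>_def)
  have "4 * W / (real n * V\<^sup>2) \<le> 4 * W / (real n * (c * (real q * s'))\<^sup>2)"
  proof (rule divide_left_mono)
    show "real n * (c * (real q * s'))\<^sup>2 \<le> real n * V\<^sup>2"
      using n0 cq V_ge by (intro mult_left_mono power_mono) auto
    show "0 < real n * V\<^sup>2 * (real n * (c * (real q * s'))\<^sup>2)"
      by (intro mult_pos_pos zero_less_power n0 V0 cq)
  qed (use W0 in simp)
  moreover have "4 * V / (real n * \<nu>\<^sup>2) \<le> 4 * (G * v) / (real n * \<nu>\<^sup>2)"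
    using n0 V_le by (intro divide_right_mono) auto
  ultimately have D_ge': "prob D \<ge> 1 - (4 * W / (real n * (c * (real q * s'))\<^sup>2) + 4 / real n
      + 4 * (G * v) / (real n * \<nu>\<^sup>2))"
    using D_ge by linarith
  define L where "L = 2 * ln (2 * real d / \<alpha>)"
  have L0: "L > 0" using d alpha by (simp add: L_def field_simps)
  have sub: "subalgebra M (data_sigma M n p X)"
    unfolding data_sigma_def by (rule subalgebra_gen_sigma) (use rv in auto)
  define E where "E = {\<omega>\<in>space M. max_stat n d X S \<omega> > quantile (K \<omega>) (1 - \<alpha>)}"
  have Kq: "(\<lambda>\<omega>. quantile (K \<omega>) (1 - \<alpha>)) \<in> borel_measurable M"
    by (rule measurable_from_subalg[OF sub borel_measurable_quantile])
      (use K alpha in \<open>auto simp: is_cond_distr_def\<close>)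
  have Ms: "max_stat n d X S \<in> borel_measurable M"
    by (rule borel_measurable_max_stat[OF rv]) (use S in auto)
  have E: "E \<in> sets M" unfolding E_def using Kq Ms by measurable
  have qu: "AE \<omega> in M. quantile (K \<omega>) (1 - \<alpha>) \<le> sqrt L * sqrt (1 + (max_stat n d X S \<omega>)\<^sup>2 / real n)"
    unfolding L_def by (rule quantile_max_boot_le[OF n d alpha rv _ xi N ind K]) (use S in auto)
  have "prob D \<le> prob E"
  proof (rule finite_measure_mono_AE[OF _ E])
    show "AE \<omega> in M. \<omega> \<in> D \<longrightarrow> \<omega> \<in> E"
      using qu AE_space
    proof eventually_elim
      case (elim \<omega>)
      show ?case
      proof
        assume \<omega>: "\<omega> \<in> D"
        define T where "T = max_stat n d X S \<omega>"
        have tT: "\<bar>t_stat n Y \<omega>\<bar> \<le> T" unfolding T_def Y_def by (rule abs_t_stat_le_max_stat[OF l])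
        then have T0: "T \<ge> 0" by linarith
        have "2 * L < real n * \<nu>\<^sup>2 / (6 * (G * v))" using power by (simp add: L_def \<nu>_def)
        also have "\<dots> \<le> real n * \<nu>\<^sup>2 / (6 * V)"
          using V_le V0 n0 G v(2) by (intro divide_left_mono) auto
        also have "\<dots> \<le> (t_stat n Y \<omega>)\<^sup>2" using \<omega> by (simp add: D_def)
        also have "\<dots> \<le> T\<^sup>2" using power_mono[OF tT, of 2] by simp
        finally have T2: "2 * L < T\<^sup>2" .
        have "2 * L \<le> real n" using L by (simp add: L_def)
        then have "L / real n \<le> 1 / 2" using n0 by (simp add: field_simps)
        then have "T\<^sup>2 * (L / real n) \<le> T\<^sup>2 * (1 / 2)" by (rule mult_left_mono) simp
        moreover have "L * (1 + T\<^sup>2 / real n) = L + T\<^sup>2 * (L / real n)" by (simp add: algebra_simps)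
        ultimately have "L * (1 + T\<^sup>2 / real n) < T\<^sup>2" using T2 by linarith
        then have "sqrt (L * (1 + T\<^sup>2 / real n)) < sqrt (T\<^sup>2)" by (rule real_sqrt_less_mono)
        then have "sqrt L * sqrt (1 + T\<^sup>2 / real n) < T" using T0 by (simp only: real_sqrt_mult real_sqrt_abs abs_of_nonneg)
        then show "\<omega> \<in> E" using elim by (simp add: E_def T_def)
      qed
    qed
  qed
  then show ?thesis using D_ge' unfolding E_def W_def s'_def \<nu>_def by linarith
qed

end

section \<open>Passage to the limit along the triangular array\<close>

theorem theorem3:
  fixes M :: "nat \<Rightarrow> 'a measure"
    and p q d :: "nat \<Rightarrow> nat"
    and X :: "nat \<Rightarrow> nat \<Rightarrow> nat \<Rightarrow> 'a \<Rightarrow> real"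
    and \<mu> :: "nat \<Rightarrow> nat \<Rightarrow> real"
    and S :: "nat \<Rightarrow> nat \<Rightarrow> nat set"
    and \<xi> :: "nat \<Rightarrow> nat \<Rightarrow> 'a \<Rightarrow> real"
    and K :: "nat \<Rightarrow> 'a \<Rightarrow> real measure"
    and lam :: "nat \<Rightarrow> real"
    and \<alpha> c0 c C :: real
  assumes alpha: "0 < \<alpha>" "\<alpha> < 1"
    and prob: "\<And>n. n \<ge> 1 \<Longrightarrow> prob_space (M n)"
    and indep: "\<And>n. n \<ge> 1 \<Longrightarrow>
          prob_space.indep_vars (M n) (\<lambda>_. Pi\<^sub>M {1..p n} (\<lambda>_. borel))
            (\<lambda>i \<omega>. \<lambda>j\<in>{1..p n}. X n i j \<omega>) {1..n}"
    and bounded: "\<And>n i j. n \<ge> 1 \<Longrightarrow> i \<in> {1..n} \<Longrightarrow> j \<in> {1..p n} \<Longrightarrow>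
          AE \<omega> in M n. \<bar>X n i j \<omega>\<bar> \<le> C"
    and C_pos: "C > 0"
    and mean: "\<And>n i j. n \<ge> 1 \<Longrightarrow> i \<in> {1..n} \<Longrightarrow> j \<in> {1..p n} \<Longrightarrow>
          (\<integral>\<omega>. X n i j \<omega> \<partial>M n) = \<mu> n j"
    and d_ge: "\<And>n. n \<ge> 1 \<Longrightarrow> d n \<ge> 2"
    and subsets: "\<And>n l. n \<ge> 1 \<Longrightarrow> l \<in> {1..d n} \<Longrightarrow> S n l \<subseteq> {1..p n} \<and> card (S n l) = q n"
    and xi_indep: "\<And>n. n \<ge> 1 \<Longrightarrow> prob_space.indep_vars (M n) (\<lambda>_. borel) (\<xi> n) {1..n}"
    and xi_normal: "\<And>n i. n \<ge> 1 \<Longrightarrow> i \<in> {1..n} \<Longrightarrow>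
          distributed (M n) lborel (\<xi> n i) std_normal_density"
    and xi_data_indep: "\<And>n. n \<ge> 1 \<Longrightarrow>
          prob_space.indep_set (M n) (sets (gen_sigma (M n) {1..n} (\<xi> n)))
            (sets (data_sigma (M n) n (p n) (X n)))"
    and cond_distr: "\<And>n. n \<ge> 1 \<Longrightarrow>
          is_cond_distr (M n) (data_sigma (M n) n (p n) (X n))
            (max_boot n (d n) (\<xi> n) (X n) (S n)) (K n)"
    and c0_pos: "c0 > 0"
    and A: "\<And>n i m. n \<ge> 1 \<Longrightarrow> i \<in> {1..n} \<Longrightarrow> 1 \<le> m \<Longrightarrow> m \<le> p n - 1 \<Longrightarrow>
          rho_mixing (M n) (p n) (X n i) m \<le> exp (- 2 * c0 * real m)"
    and c_pos: "c > 0"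
    and B': "\<And>n i l. n \<ge> 1 \<Longrightarrow> i \<in> {1..n} \<Longrightarrow> l \<in> {1..d n} \<Longrightarrow>
          prob_space.variance (M n) (block_sum (X n) (S n l) i)
            \<ge> c * (\<Sum>j\<in>S n l. prob_space.variance (M n) (X n i j))"
    and C'1: "(\<lambda>n. max_moment (M n) n (p n) (X n) (\<mu> n) 4
            / (min_moment (M n) n (p n) (X n) (\<mu> n) 2)\<^sup>2)
          \<in> o(\<lambda>n. real n * real (q n) / ln (real (p n * n)) ^ 5)"
    and C'2: "(\<lambda>n. max_moment (M n) n (p n) (X n) (\<mu> n) 2
            / min_moment (M n) n (p n) (X n) (\<mu> n) 2)
          \<in> o(\<lambda>n. min (sqrt (real n / ln (real (p n * n)) ^ 5)) ((ln (real (p n)))\<^sup>2))"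
    and D1: "\<forall>\<^sub>F n in sequentially. q n < p n"
    and D2: "(\<lambda>n. ln (real (q n))) \<in> O(\<lambda>n. ln (real (p n)))"
    and D3: "(\<lambda>n. ln (real (d n))) \<in> O(\<lambda>n. ln (real (p n)))"
    and D4: "filterlim (\<lambda>n. real n / ln (real (p n * n)) ^ 5) at_top sequentially"
    and D5: "filterlim (\<lambda>n. real n * real (q n) * min_moment (M n) n (p n) (X n) (\<mu> n) 2
            / ln (real (p n * n)) ^ 9) at_top sequentially"
    and lam: "filterlim lam at_top sequentially"
    and H1: "\<And>n. n \<ge> 1 \<Longrightarrow>
          (MAX l\<in>{1..d n}. \<bar>\<Sum>j\<in>S n l. \<mu> n j\<bar>
              / sqrt (real (q n) * max_moment (M n) n (p n) (X n) (\<mu> n) 2))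
            \<ge> sqrt (lam n * ln (real (d n))) / sqrt (real n)"
  shows "(\<lambda>n. measure (M n)
            {\<omega> \<in> space (M n).
               max_stat n (d n) (X n) (S n) \<omega> > quantile (K n \<omega>) (1 - \<alpha>)})
         \<longlonglongrightarrow> 1"
proof -
  \<comment> \<open>Chosen so that \<open>\<tau> ^ 12\<close> is \<open>exp (- 2 * c0)\<close>, the
    rate in assumption \<open>A\<close>.\<close>
  define \<tau> where "\<tau> = exp (- c0 / 6)"
  define G where "G = 2 / (1 - \<tau>)"
  \<comment> \<open>Since \<open>ln 2 <= ln (d n)\<close>, this factor absorbs
    \<open>ln (2 / \<alpha>)\<close> into a multiple of \<open>ln (d n)\<close>.\<close>
  define \<kappa> where "\<kappa> = 1 + ln (2 / \<alpha>) / ln 2"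
  \<comment> \<open>\<open>a1\<close> and \<open>a2\<close> are what the two parts of the fourth
    moment bound leave after division by the squared lower variance bound.\<close>
  define a1 where "a1 = 4 * ((2 * C)\<^sup>2 * G ^ 3) / c\<^sup>2"
  define a2 where "a2 = 12 * G\<^sup>2 / c\<^sup>2"
  define ell where "ell n = ln (real (p n * n))" for n
  define smax where "smax n = max_moment (M n) n (p n) (X n) (\<mu> n) 2" for n
  define smin where "smin n = min_moment (M n) n (p n) (X n) (\<mu> n) 2" for n
  \<comment> \<open>The first two terms come from the deviation of the second moment, the last two
    from the two deviations of the sample mean.\<close>
  define e where "e n = a1 * inverse (real n * real (q n) * smin n / ell n ^ 9) + a2 * inverse (ln (real n))
    + 4 / real n + 4 * G / ln 2 * inverse (lam n)" for n
  let ?P = "\<lambda>n. measure (M n) {\<omega> \<in> space (M n). max_stat n (d n) (X n) (S n) \<omega> > quantile (K n \<omega>) (1 - \<alpha>)}"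
  have tau: "0 \<le> \<tau>" "\<tau> < 1" using c0_pos by (auto simp: \<tau>_def)
  have G: "G > 0" using tau by (simp add: G_def)
  have tau_power: "\<tau> ^ (12 * m) = exp (- 2 * c0 * real m)" for m
    by (simp add: \<tau>_def exp_of_nat_mult[symmetric])
  have \<kappa>: "\<kappa> \<ge> 1" using alpha by (simp add: \<kappa>_def)
  have a: "a1 \<ge> 0" "a2 \<ge> 0" using C_pos c_pos G by (auto simp: a1_def a2_def)
  obtain K' where K': "K' > 0" "\<forall>\<^sub>F n in sequentially. norm (ln (real (d n))) \<le> K' * norm (ln (real (p n)))"
    using D3 by (auto elim!: landau_o.bigE)
  have e0: "e \<longlonglongrightarrow> 0"
  proof -
    have 1: "(\<lambda>n. inverse (real n * real (q n) * smin n / ell n ^ 9)) \<longlonglongrightarrow> 0"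
      using D5 unfolding smin_def ell_def by (rule tendsto_inverse_0_at_top)
    have 2: "(\<lambda>n. inverse (ln (real n))) \<longlonglongrightarrow> 0"
      by (intro tendsto_inverse_0_at_top filterlim_compose[OF ln_at_top filterlim_real_sequentially])
    have 3: "(\<lambda>n. inverse (lam n)) \<longlonglongrightarrow> 0"
      by (rule tendsto_inverse_0_at_top[OF lam])
    have 4: "(\<lambda>n. 4 / real n) \<longlonglongrightarrow> 0"
      by (rule lim_const_over_n)
    have "e \<longlonglongrightarrow> a1 * 0 + a2 * 0 + 0 + 4 * G / ln 2 * 0"
      unfolding e_def by (intro tendsto_intros 1 2 3 4)
    then show ?thesis by simp
  qed
  have low: "\<forall>\<^sub>F n in sequentially. 1 - e n \<le> ?P n"
  proof -
    have r: "\<forall>\<^sub>F n in sequentially. norm (smax n / smin n)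
        \<le> 1 * norm (min (sqrt (real n / ell n ^ 5)) ((ln (real (p n)))\<^sup>2))"
      using landau_o.smallD[OF C'2, of 1] unfolding smax_def smin_def ell_def by simp
    have D5': "\<forall>\<^sub>F n in sequentially. real n * real (q n) * smin n / ell n ^ 9 \<ge> 1"
      using D5 unfolding smin_def ell_def filterlim_at_top by blast
    \<comment> \<open>Sized so that \<open>4 * ln (2 * d n / \<alpha>) <= n\<close>, by way of
      \<open>ln (d n) <= K' * ell n <= K' * ell n ^ 5\<close>.\<close>
    have D4': "\<forall>\<^sub>F n in sequentially. real n / ell n ^ 5 \<ge> 4 * \<kappa> * K'"
      using D4 unfolding ell_def filterlim_at_top by blast
    \<comment> \<open>The 24 is the 4 of the threshold times the 6 of the lower bound for the
      squared statistic; the added 1 makes the comparison strict.\<close>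
    have lam': "\<forall>\<^sub>F n in sequentially. lam n \<ge> 24 * G * \<kappa> + 1"
      using lam unfolding filterlim_at_top by blast
    show ?thesis
      using r D5' D4' lam' D1 K'(2) eventually_ge_at_top[of 3]
    proof eventually_elim
      case (elim n)
      note r = elim(1) and D5 = elim(2) and D4 = elim(3) and lam = elim(4) and qp = elim(5)
        and dK = elim(6) and n3 = elim(7)
      have n1: "n \<ge> 1" using n3 by simp
      interpret prob_space "M n" by (rule prob[OF n1])
      have p1: "p n \<ge> 1" using qp by simp
      have pn: "real (p n * n) \<ge> real n" "real (p n * n) \<ge> real (p n)"
        using p1 n1 by (simp_all flip: of_nat_mult)
      \<comment> \<open>From \<open>n = 3\<close> on, \<open>ell n\<close> is at least 1, so that
        its powers increase with the exponent.\<close>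
      have ln_n: "1 \<le> ln (real n)"
      proof -
        have "1 < ln (3::real)" by (rule ln3_gt_1)
        also have "\<dots> \<le> ln (real n)" using n3 by simp
        finally show ?thesis by simp
      qed
      have ell: "ln (real n) \<le> ell n" "ln (real (p n)) \<le> ell n" "0 \<le> ln (real (p n))"
        unfolding ell_def using pn p1 n1 by (simp_all add: ln_mono)
      have ell1: "1 \<le> ell n" using ln_n ell by simp
      \<comment> \<open>The quotient in \<open>D5\<close> being eventually at least 1 is the source
        of both \<open>q n >= 1\<close> and \<open>smin n > 0\<close>.\<close>
      have pos: "real n * real (q n) * smin n > 0"
      proof -
        have "ell n ^ 9 > 0" using ell1 by simp
        moreover from this have "ell n ^ 9 \<le> real n * real (q n) * smin n"
          using D5 by (simp only: le_divide_eq) simp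
        ultimately show ?thesis by linarith
      qed
      then have q1: "q n \<ge> 1" by (cases "q n = 0") auto
      have smin0: "smin n > 0" using zero_less_mult_pos[OF pos] q1 n1 by simp
      have s_le: "smin n \<le> smax n"
        using min_moment_le_moment[where i = 1 and j = 1 and n = n and p = "p n" and X = "X n" and M = "M n" and \<mu> = "\<mu> n" and r = 2]
          moment_le_max_moment[where i = 1 and j = 1 and n = n and p = "p n" and X = "X n" and M = "M n" and \<mu> = "\<mu> n" and r = 2] n1 p1
        unfolding smin_def smax_def by simp
      then have smax0: "smax n > 0" using smin0 by simp
      define v where "v = real (q n) * smax n"
      have v0: "v > 0" using q1 smax0 by (simp add: v_def)
      have d2: "d n \<ge> 2" by (rule d_ge[OF n1])
      have lnd: "ln 2 \<le> ln (real (d n))" using d2 by simp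
      have lnd0: "ln (real (d n)) > 0" using d2 by simp
      have lam0: "lam n > 0" "lam n > 24 * G * \<kappa>"
        using lam mult_pos_pos[OF G, of \<kappa>] \<kappa> by auto
      \<comment> \<open>The finite maximum in \<open>H1\<close> is attained, and this one block
        carries the rest of the argument.\<close>
      obtain l where l: "l \<in> {1..d n}"
        and H: "sqrt (lam n * ln (real (d n))) / sqrt (real n) \<le> \<bar>\<Sum>j\<in>S n l. \<mu> n j\<bar> / sqrt v"
      proof -
        let ?f = "\<lambda>l. \<bar>\<Sum>j\<in>S n l. \<mu> n j\<bar> / sqrt v"
        have "Max (?f ` {1..d n}) \<in> ?f ` {1..d n}" using d2 by (intro Max_in) auto
        then obtain l where "l \<in> {1..d n}" "Max (?f ` {1..d n}) = ?f l" by auto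
        then show ?thesis using that[of l] H1[OF n1] unfolding v_def smax_def by simp
      qed
      define m where "m = (\<Sum>j\<in>S n l. \<mu> n j)"
      have m2: "lam n * ln (real (d n)) \<le> real n * m\<^sup>2 / v"
      proof -
        have "(sqrt (lam n * ln (real (d n))) / sqrt (real n))\<^sup>2 \<le> (\<bar>m\<bar> / sqrt v)\<^sup>2"
          using H lam0 lnd0 unfolding m_def by (intro power_mono) auto
        then have "lam n * ln (real (d n)) / real n \<le> m\<^sup>2 / v"
          using lam0 lnd0 v0 by (simp add: power_divide)
        then show ?thesis using n1 by (simp add: field_simps)
      qed
      have ll: "lam n * ln (real (d n)) > 0" using lam0 lnd0 by simp
      have m0: "m \<noteq> 0" using m2 ll by auto
      have lnda: "ln (2 * real (d n) / \<alpha>) \<le> \<kappa> * ln (real (d n))"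
      proof -
        have "ln (2 * real (d n) / \<alpha>) = ln (real (d n) * (2 / \<alpha>))" by (simp add: mult.commute)
        also have "\<dots> = ln (real (d n)) + ln (2 / \<alpha>)"
          using d2 alpha by (intro ln_mult_pos) auto
        also have "ln (2 / \<alpha>) = ln (2 / \<alpha>) / ln 2 * ln 2" by simp
        also have "\<dots> \<le> ln (2 / \<alpha>) / ln 2 * ln (real (d n))"
          using alpha lnd by (intro mult_left_mono) auto
        finally show ?thesis by (simp add: \<kappa>_def algebra_simps)
      qed
      have power: "4 * ln (2 * real (d n) / \<alpha>) < real n * m\<^sup>2 / (6 * (G * v))"
      proof -
        have "4 * ln (2 * real (d n) / \<alpha>) \<le> 4 * \<kappa> * ln (real (d n))" using lnda by simp
        also have "\<dots> = (24 * G * \<kappa>) * ln (real (d n)) / (6 * G)" using G by simp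
        also have "\<dots> < lam n * ln (real (d n)) / (6 * G)"
          using lam0 lnd0 G by (intro divide_strict_right_mono mult_strict_right_mono) auto
        also have "\<dots> \<le> (real n * m\<^sup>2 / v) / (6 * G)" using m2 G by (intro divide_right_mono) auto
        finally show ?thesis by (simp add: field_simps)
      qed
      have L: "4 * ln (2 * real (d n) / \<alpha>) \<le> real n"
      proof -
        have "ln (real (d n)) \<le> K' * ell n"
        proof -
          have "ln (real (d n)) \<le> K' * ln (real (p n))" using dK ell(3) lnd0 by simp
          also have "\<dots> \<le> K' * ell n" using ell K'(1) by simp
          finally show ?thesis .
        qed
        also have "K' * ell n \<le> K' * ell n ^ 5"
          using K'(1) power_increasing[of 1 5 "ell n"] ell1 by simp
        finally have "4 * \<kappa> * ln (real (d n)) \<le> 4 * \<kappa> * (K' * ell n ^ 5)"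
          using \<kappa> by (intro mult_left_mono) auto
        also have "\<dots> \<le> real n"
          using D4 ell1 by (simp add: le_divide_eq mult.assoc)
        finally show ?thesis using lnda by simp
      qed
      have T1: "4 * ((2 * C)\<^sup>2 * G ^ 3 * v + 3 * G\<^sup>2 * v\<^sup>2) / (real n * (c * (real (q n) * smin n))\<^sup>2)
          \<le> a1 * inverse (real n * real (q n) * smin n / ell n ^ 9) + a2 * inverse (ln (real n))"
      proof -
        \<comment> \<open>Two bounds on the variance ratio serve two terms: the logarithmic one is
          swallowed by \<open>ell n ^ 9\<close>, while the square-root one cancels the
          \<open>n\<close> and leaves an inverse power of \<open>ell n\<close>.\<close>
        define \<rho> where "\<rho> = smax n / smin n"
        have \<rho>0: "\<rho> > 0" using smax0 smin0 by (simp add: \<rho>_def)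
        have \<rho>: "\<rho> \<le> sqrt (real n / ell n ^ 5)" "\<rho> \<le> (ln (real (p n)))\<^sup>2"
          using r \<rho>0 ell1 unfolding \<rho>_def[symmetric] by (auto simp: min_def split: if_splits)
        have "4 * ((2 * C)\<^sup>2 * G ^ 3 * v + 3 * G\<^sup>2 * v\<^sup>2) / (real n * (c * (real (q n) * smin n))\<^sup>2)
            = a1 * (\<rho> / (real n * real (q n) * smin n)) + a2 * (\<rho>\<^sup>2 / real n)"
          using n1 q1 smin0 c_pos unfolding a1_def a2_def \<rho>_def v_def
          by (simp add: field_simps power2_eq_square)
        also have "\<dots> \<le> a1 * inverse (real n * real (q n) * smin n / ell n ^ 9) + a2 * inverse (ln (real n))"
        proof (intro add_mono mult_left_mono a)
          have "\<rho> \<le> ell n ^ 2" using \<rho>(2) power_mono[OF ell(2,3), of 2] by simp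
          also have "\<dots> \<le> ell n ^ 9" using ell1 by (intro power_increasing) auto
          finally show "\<rho> / (real n * real (q n) * smin n) \<le> inverse (real n * real (q n) * smin n / ell n ^ 9)"
            using pos by (simp add: divide_right_mono)
          have "\<rho>\<^sup>2 \<le> (sqrt (real n / ell n ^ 5))\<^sup>2" using \<rho>(1) \<rho>0 by (intro power_mono) auto
          also have "\<dots> = real n / ell n ^ 5" using ell1 by simp
          finally have "\<rho>\<^sup>2 / real n \<le> inverse (ell n ^ 5)" using n1 by (simp add: field_simps)
          also have "\<dots> \<le> inverse (ln (real n))"
            using power_increasing[of 1 5 "ell n"] ell1 ell(1) ln_n by (intro le_imp_inverse_le) auto
          finally show "\<rho>\<^sup>2 / real n \<le> inverse (ln (real n))" .
        qed
        finally show ?thesis .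
      qed
      have T3: "4 * (G * v) / (real n * m\<^sup>2) \<le> 4 * G / ln 2 * inverse (lam n)"
      proof -
        have "4 * (G * v) / (real n * m\<^sup>2) = 4 * G / (real n * m\<^sup>2 / v)" using v0 by simp
        also have "\<dots> \<le> 4 * G / (lam n * ln (real (d n)))"
          using m2 lam0 lnd0 G n1 m0 v0 by (intro divide_left_mono mult_pos_pos divide_pos_pos) auto
        \<comment> \<open>As \<open>d n\<close> may stay bounded, the decay is left to
          \<open>lam n\<close> alone.\<close>
        also have "\<dots> \<le> 4 * G / (lam n * ln 2)"
          using lam0 lnd lnd0 G by (intro divide_left_mono mult_left_mono mult_pos_pos) auto
        finally show ?thesis by (simp add: field_simps)
      qed
      have "1 - (4 * ((2 * C)\<^sup>2 * G ^ 3 * v + 3 * G\<^sup>2 * v\<^sup>2) / (real n * (c * (real (q n) * smin n))\<^sup>2)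
          + 4 / real n + 4 * (G * v) / (real n * m\<^sup>2)) \<le> ?P n"
        unfolding m_def smin_def
      proof (rule prob_max_stat_gt_quantile_ge[OF n1 _ alpha indep[OF n1] bounded[OF n1] C_pos mean[OF n1]
            subsets[OF n1] xi_indep[OF n1] xi_normal[OF n1] xi_data_indep[OF n1] cond_distr[OF n1] tau _
            c_pos B'[OF n1] q1 _ l])
        show "rho_mixing (M n) (p n) (X n i) m \<le> \<tau> ^ (12 * m)" if "i \<in> {1..n}" "1 \<le> m" "m \<le> p n - 1" for i m
          unfolding tau_power by (rule A[OF n1 that])
        show "0 < min_moment (M n) n (p n) (X n) (\<mu> n) 2" using smin0 by (simp add: smin_def)
        show "v = real (q n) * max_moment (M n) n (p n) (X n) (\<mu> n) 2" by (simp add: v_def smax_def)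
      qed (use d2 m0 L power in \<open>simp_all add: m_def G_def\<close>)
      then show ?case using T1 T3 unfolding e_def by linarith
    qed
  qed
  show ?thesis
  proof (rule tendsto_sandwich[OF low _ _ tendsto_const])
    show "\<forall>\<^sub>F n in sequentially. ?P n \<le> 1"
      using eventually_ge_at_top[of 1]
      by eventually_elim (rule prob_space.prob_le_1[OF prob])
    show "(\<lambda>n. 1 - e n) \<longlonglongrightarrow> 1"
      using tendsto_diff[OF tendsto_const[of 1] e0] by simp
  qed
qed

end
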